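(* Let $N\in\mathbb{Z}^+$ and let $p$ be a prime. The set of algebraic numbers $j\in\overline{\mathbb{Q}}$ for which there exist a number field $F$ with $p\nmid[F:\mathbb{Q}]$ and an elliptic curve $E_{/F}$ with $j(E)=j$ and a point of order $N$ in $E(F)$ is infinite. *)

theory Defs
  imports
    Complex_Main
    "HOL-Computational_Algebra.Polynomial"
    "HOL-Algebra.Embedded_Algebras"
    "HOL-Algebra.Multiplicative_Group"
    "HOL-Algebra.Algebraic_Closure_Type"
begin

section \<open>Number fields inside the complex numbers\<close>

text \<open>
  The field of algebraic numbers is taken to be \<^term>\<open>{z::complex. algebraic z}\<close>, and number
  fields are taken as subfields of \<open>\<complex>\<close>. This is also what gives a meaning to the equation
  \<open>j(E) = j\<close> between an element of the number field and an algebraic number.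
\<close>

abbreviation complex_ring :: "complex ring" where
  "complex_ring \<equiv> ring_of_type_algebra"

definition number_field :: "complex set \<Rightarrow> bool" where
  "number_field F \<longleftrightarrow> subfield F complex_ring \<and> ring.finite_dimension complex_ring \<rat> F"

definition degree_over_rat :: "complex set \<Rightarrow> nat" where
  "degree_over_rat F = ring.dim complex_ring \<rat> F"


section \<open>Elliptic curves\<close>

text \<open>
  The curve \<open>y\<^sup>2 + a\<^sub>1 x y + a\<^sub>3 y = x\<^sup>3 + a\<^sub>2 x\<^sup>2 + a\<^sub>4 x + a\<^sub>6\<close>, with the usual names for the
  coefficients and for the quantities derived from them.
\<close>

datatype 'a weierstrass =
  Weierstrass (wa1: 'a) (wa2: 'a) (wa3: 'a) (wa4: 'a) (wa6: 'a)

definition wb2 :: "'a::field weierstrass \<Rightarrow> 'a" where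
  "wb2 E = wa1 E ^ 2 + 4 * wa2 E"

definition wb4 :: "'a::field weierstrass \<Rightarrow> 'a" where
  "wb4 E = 2 * wa4 E + wa1 E * wa3 E"

definition wb6 :: "'a::field weierstrass \<Rightarrow> 'a" where
  "wb6 E = wa3 E ^ 2 + 4 * wa6 E"

definition wb8 :: "'a::field weierstrass \<Rightarrow> 'a" where
  "wb8 E = wa1 E ^ 2 * wa6 E + 4 * wa2 E * wa6 E - wa1 E * wa3 E * wa4 E
           + wa2 E * wa3 E ^ 2 - wa4 E ^ 2"

definition wc4 :: "'a::field weierstrass \<Rightarrow> 'a" where
  "wc4 E = wb2 E ^ 2 - 24 * wb4 E"

definition discriminant :: "'a::field weierstrass \<Rightarrow> 'a" where
  "discriminant E = - (wb2 E ^ 2) * wb8 E - 8 * wb4 E ^ 3 - 27 * wb6 E ^ 2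
                    + 9 * wb2 E * wb4 E * wb6 E"

definition j_invariant :: "'a::field weierstrass \<Rightarrow> 'a" where
  "j_invariant E = wc4 E ^ 3 / discriminant E"

definition elliptic_curve_over :: "'a::field set \<Rightarrow> 'a weierstrass \<Rightarrow> bool" where
  "elliptic_curve_over F E \<longleftrightarrow> set_weierstrass E \<subseteq> F \<and> discriminant E \<noteq> 0"

datatype 'a point = Infinity | Affine 'a 'a

fun on_curve :: "'a::field weierstrass \<Rightarrow> 'a point \<Rightarrow> bool" where
  "on_curve E Infinity \<longleftrightarrow> True"
| "on_curve E (Affine x y) \<longleftrightarrow>
     y ^ 2 + wa1 E * x * y + wa3 E * y = x ^ 3 + wa2 E * x ^ 2 + wa4 E * x + wa6 E"

definition rational_points :: "'a::field set \<Rightarrow> 'a weierstrass \<Rightarrow> 'a point set" where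
  "rational_points F E = {P. on_curve E P \<and> set_point P \<subseteq> F}"

text \<open>
  The chord and tangent law. The slope \<open>l\<close> is that of the line through the two points, or of the
  tangent line if they coincide. If \<open>x\<^sub>1 = x\<^sub>2\<close> but the points are not opposite to each other, then
  they are equal.
\<close>

fun point_add :: "'a::field weierstrass \<Rightarrow> 'a point \<Rightarrow> 'a point \<Rightarrow> 'a point" where
  "point_add E Infinity Q = Q"
| "point_add E (Affine x1 y1) Infinity = Affine x1 y1"
| "point_add E (Affine x1 y1) (Affine x2 y2) =
     (if x1 = x2 \<and> y1 + y2 + wa1 E * x2 + wa3 E = 0 then Infinity
      else
        let l = (if x1 = x2
                 then (3 * x1 ^ 2 + 2 * wa2 E * x1 + wa4 E - wa1 E * y1)
                      / (2 * y1 + wa1 E * x1 + wa3 E)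
                 else (y2 - y1) / (x2 - x1));
            x3 = l ^ 2 + wa1 E * l - wa2 E - x1 - x2
        in Affine x3 (l * (x1 - x3) - y1 - wa1 E * x3 - wa3 E))"

definition point_group :: "'a::field set \<Rightarrow> 'a weierstrass \<Rightarrow> 'a point monoid" where
  "point_group F E =
     \<lparr>carrier = rational_points F E, monoid.mult = point_add E, one = Infinity\<rparr>"

text \<open>
  The order is spelled out because \<^const>\<open>group.ord\<close> can only be unfolded once the chord and
  tangent law has been shown to be a group law. The two agree on every group.
\<close>

definition has_order :: "('a, 'b) monoid_scheme \<Rightarrow> 'a \<Rightarrow> nat \<Rightarrow> bool" where
  "has_order G P n \<longleftrightarrow> 0 < n \<and> P [^]\<^bsub>G\<^esub> n = \<one>\<^bsub>G\<^esub> \<and>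
     (\<forall>m. 0 < m \<and> m < n \<longrightarrow> P [^]\<^bsub>G\<^esub> m \<noteq> \<one>\<^bsub>G\<^esub>)"

lemma (in group) has_order_iff_ord:
  assumes "P \<in> carrier G" and "0 < n"
  shows "has_order G P n \<longleftrightarrow> ord P = n"
proof
  assume h: "has_order G P n"
  then have "ord P dvd n"
    using pow_eq_id[OF assms(1)] by (simp add: has_order_def)
  moreover have "P [^] ord P = \<one>"
    using pow_eq_id[OF assms(1)] by simp
  ultimately show "ord P = n"
    using h by (metis has_order_def dvd_imp_le dvd_pos_nat le_neq_implies_less)
next
  assume "ord P = n"
  then show "has_order G P n"
    using pow_eq_id[OF assms(1)] assms(2) by (auto simp: has_order_def dest: dvd_imp_le)
qed

end

(*
The points (t, r) with t not 0 parametrise curves y^2 + a1 x y + t y = x^3 + t (1 - t) x^2 with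
a1 = 1 + 2 t + r t^(N - 3), and P = (0, 0) has order N on the points of a plane curve over Q.
The line r = 0 consists of nodal cubics. Comparing the multiples of P with those on the nodal
cubics, one finds that as t tends to 0 the slope of the line through P and (N - 2) P, which
vanishes exactly when N P = O, is -t (1 + r) to leading order, while the slopes that would give P
a smaller order are -t. Hence some component C of the curve {N P = O} passes through the rational
point (0, -1), a cusp of X_1(N), which is smooth on C and transversal to t = 0. Moreover C is not
contained in the zero set of the discriminant, of a condition for smaller order, or of a polynomial
condition on j.

Counted with multiplicity, the curves r = -1 + s t^i + t^M meet C away from the cusp in D points
for i = 0 and in D - 1 points for i = 1. One of the two numbers is prime to p, and then some Galois
orbit of intersection points has size prime to p. For generic rational s the intersection points
avoid any given finite set of j-invariants.
*)

theory Submission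
  imports Defs "HOL-Computational_Algebra.Polynomial_Factorial"
    "HOL-Computational_Algebra.Field_as_Ring"
begin

text \<open>The exponent N - 3 is dictated by the growth of errors. Each slope has size t, yet it is
  computed from the terms 1 and t / x, which cancel to leading order as t / x tends to -1. So a
  relative error of an abscissa is magnified by 1 / t in the next slope. With K = N - 4, changing a1
  by r t^(K + 1) alters the slope at index m by the relative amount r t^(K - m), and this stays
  visible in the limit only at index K.

  C is taken irreducible over Q, so that a condition which does not contain C meets it over finitely
  many t. The cusp is also the test point for this: apart from powers of t, the conditions for
  smaller orders become nonzero constants on t = 0, the discriminant becomes a nonzero multiple of
  r, and j has a pole at the cusp.

  M exceeds the degree in t of every coefficient of the equation of C, so D depends neither on s nor
  on i. For i = 1 every curve of the pencil passes through the cusp, and for all but one s it does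
  so with multiplicity one; this is the point missing from D - 1.

  The index K exists only for N at least 4. For smaller N there are families over Q itself.\<close>

subsection \<open>Evaluation of rational polynomials\<close>

lemma poly_map_poly_add:
  fixes h :: "'a::comm_ring_1 \<Rightarrow> 'b::comm_ring_1"
  assumes "h 0 = 0" "\<And>a b. h (a + b) = h a + h b"
  shows "poly (map_poly h (p + q)) x = poly (map_poly h p) x + poly (map_poly h q) x"
  by (induction p q rule: poly_induct2) (simp_all add: map_poly_pCons assms algebra_simps)

text \<open>\<open>h\<close> stays general because it will be the coercion of coefficients in
  \<open>rpoly\<close>, evaluation in t in \<open>bpoly\<close>, and evaluation at 0 in
  \<open>fibre0\<close>.\<close>

lemma poly_map_poly_mult:
  fixes h :: "'a::comm_ring_1 \<Rightarrow> 'b::comm_ring_1"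
  assumes "h 0 = 0" "\<And>a b. h (a + b) = h a + h b" "\<And>a b. h (a * b) = h a * h b"
  shows "poly (map_poly h (p * q)) x = poly (map_poly h p) x * poly (map_poly h q) x"
proof (induction p)
  case (pCons a p)
  have "poly (map_poly h (smult a q)) x = h a * poly (map_poly h q) x"
    by (induction q) (simp_all add: map_poly_pCons assms algebra_simps)
  with pCons show ?case
    by (simp add: map_poly_pCons assms poly_map_poly_add algebra_simps)
qed simp

text \<open>The target field is left open: limits at the cusp are taken over the reals, points of
  the curve over the complex numbers.\<close>

definition rpoly :: "rat poly \<Rightarrow> 'a::field_char_0 \<Rightarrow> 'a" where
  "rpoly p x = poly (map_poly of_rat p) x"

lemma rpoly_0 [simp]: "rpoly 0 x = 0"
  and rpoly_pCons [simp]: "rpoly (pCons a p) x = of_rat a + x * rpoly p x"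
  by (simp_all add: rpoly_def map_poly_pCons)

lemma rpoly_1 [simp]: "rpoly 1 x = 1"
  by (simp add: one_pCons)

lemma rpoly_add [simp]: "rpoly (p + q) x = rpoly p x + rpoly q x"
  unfolding rpoly_def by (rule poly_map_poly_add) (simp_all add: of_rat_add)

lemma rpoly_mult [simp]: "rpoly (p * q) x = rpoly p x * rpoly q x"
  unfolding rpoly_def by (rule poly_map_poly_mult) (simp_all add: of_rat_add of_rat_mult)

lemma rpoly_minus [simp]: "rpoly (- p) x = - rpoly p x"
  using rpoly_add[of p "- p" x] by (simp add: eq_neg_iff_add_eq_0 add.commute)

lemma rpoly_diff [simp]: "rpoly (p - q) x = rpoly p x - rpoly q x"
  using rpoly_add[of p "- q" x] by simp

lemma rpoly_monom [simp]: "rpoly (monom a n) x = of_rat a * x ^ n"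
  by (simp add: rpoly_def map_poly_monom poly_monom)

lemma rpoly_of_rat: "rpoly p (of_rat x) = of_rat (poly p x)"
  by (induction p) (simp_all add: of_rat_add of_rat_mult)

lemma rpoly_root_unit: "is_unit p \<Longrightarrow> rpoly p x \<noteq> 0"
  by (metis dvdE mult_eq_0_iff rpoly_1 rpoly_mult zero_neq_one)

lemma degree_map_poly_of_rat [simp]:
  "degree (map_poly (of_rat :: rat \<Rightarrow> 'a::field_char_0) p) = degree p"
  by (rule degree_map_poly) simp

lemma map_poly_of_rat_eq_0_iff [simp]:
  "map_poly (of_rat :: rat \<Rightarrow> 'a::field_char_0) p = 0 \<longleftrightarrow> p = 0"
  by (rule map_poly_eq_0_iff) simp_all

lemma finite_rpoly_roots: "p \<noteq> 0 \<Longrightarrow> finite {x. rpoly p x = 0}"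
  unfolding rpoly_def by (rule poly_roots_finite) simp

lemma irreducible_dvd_if_common_root:
  fixes p q :: "rat poly" and z :: "'a::field_char_0"
  assumes "irreducible p" "rpoly p z = 0" "rpoly q z = 0"
  shows "p dvd q"
proof (rule ccontr)
  assume "\<not> p dvd q"
  then have "coprime p q"
    using assms(1) by (simp add: prime_elem_imp_coprime irreducible_imp_prime_elem)
  then obtain u v where "u * p + v * q = 1"
    by (metis bezout_coefficients_fst_snd coprime_imp_gcd_eq_1)
  then have "rpoly (u * p + v * q) z = 1" by simp
  with assms show False by simp
qed

lemma algebraic_imp_rpoly_root:
  assumes "algebraic (x :: 'a::field_char_0)"
  obtains p where "p \<noteq> 0" "rpoly p x = 0"
proof -
  obtain p where p: "p \<noteq> 0" "poly (map_poly of_int p) x = 0"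
    using assms by (rule algebraicE')
  have "rpoly (map_poly of_int p) x = poly (map_poly of_int p) x"
    by (simp add: rpoly_def map_poly_map_poly o_def)
  moreover have "map_poly of_int p \<noteq> (0 :: rat poly)"
    using p(1) by (subst map_poly_eq_0_iff) simp_all
  ultimately show ?thesis using that p(2) by metis
qed

subsection \<open>Simple extensions of the rational numbers\<close>

lemma field_complex_ring: "field complex_ring"
  by (rule field_from_type_algebra)

interpretation CR: domain complex_ring
  using field_complex_ring by (rule field.axioms)

lemma complex_ring_simps [simp]:
  "carrier complex_ring = UNIV" "zero complex_ring = 0" "one complex_ring = 1"
  "add complex_ring = (+)" "monoid.mult complex_ring = (*)"
  by (simp_all add: ring_of_type_algebra_def)

lemma complex_ring_minus [simp]: "a_inv complex_ring x = - x"
  by (rule CR.minus_equality) simp_all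

lemma complex_ring_inv: "x \<noteq> 0 \<Longrightarrow> m_inv complex_ring x = inverse x"
  by (rule CR.comm_inv_char) simp_all

lemma complex_ring_pow [simp]: "x [^]\<^bsub>complex_ring\<^esub> (n::nat) = x ^ n"
  by (induction n) (simp_all add: CR.nat_pow_Suc2)

lemma subfield_complex_ringI:
  assumes "0 \<in> K" "1 \<in> K" "\<And>x y. x \<in> K \<Longrightarrow> y \<in> K \<Longrightarrow> x - y \<in> K"
    "\<And>x y. x \<in> K \<Longrightarrow> y \<in> K \<Longrightarrow> x * y \<in> K" "\<And>x. x \<in> K \<Longrightarrow> x \<noteq> 0 \<Longrightarrow> inverse x \<in> K"
  shows "subfield K complex_ring"
proof -
  have minus: "- x \<in> K" if "x \<in> K" for x
    using assms(3)[OF assms(1) that] by simp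
  have add: "x + y \<in> K" if "x \<in> K" "y \<in> K" for x y
    using assms(3)[OF that(1) minus[OF that(2)]] by simp
  have "subring K complex_ring"
    by (rule CR.subringI) (use assms minus add in auto)
  then show ?thesis
    by (rule field.subfieldI'[OF field_complex_ring]) (auto simp: complex_ring_inv assms)
qed

lemma subfield_complex_ringD:
  assumes "subfield K complex_ring"
  shows "1 \<in> K" "\<And>x y. x \<in> K \<Longrightarrow> y \<in> K \<Longrightarrow> x + y \<in> K" "\<And>x y. x \<in> K \<Longrightarrow> y \<in> K \<Longrightarrow> x * y \<in> K"
    "\<And>x. x \<in> K \<Longrightarrow> - x \<in> K"
  using subringE[OF subfieldE(1)[OF assms]] by auto

lemma subfield_Rats: "subfield \<rat> complex_ring"
  by (rule subfield_complex_ringI) auto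

definition adjoin :: "complex \<Rightarrow> complex set" where
  "adjoin z = range (\<lambda>p. rpoly p z)"

lemma adjoinI: "rpoly p z \<in> adjoin z"
  by (simp add: adjoin_def)

lemma adjoin_generator: "z \<in> adjoin z"
  unfolding adjoin_def by (rule range_eqI[of _ _ "[:0, 1:]"]) simp

lemma subfield_adjoin:
  assumes g: "irreducible g" "rpoly g z = 0"
  shows "subfield (adjoin z) complex_ring"
proof (rule subfield_complex_ringI)
  show "0 \<in> adjoin z" "1 \<in> adjoin z"
    using adjoinI[of 0 z] adjoinI[of 1 z] by simp_all
  fix x y assume "x \<in> adjoin z" "y \<in> adjoin z"
  then obtain p q where "x = rpoly p z" "y = rpoly q z" by (auto simp: adjoin_def)
  then show "x - y \<in> adjoin z" "x * y \<in> adjoin z"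
    using adjoinI[of "p - q" z] adjoinI[of "p * q" z] by simp_all
next
  fix x assume "x \<in> adjoin z" "x \<noteq> 0"
  then obtain p where p: "x = rpoly p z" by (auto simp: adjoin_def)
  then have "\<not> g dvd p"
    using \<open>x \<noteq> 0\<close> g(2) by (auto elim!: dvdE)
  then have "coprime g p"
    using g(1) by (simp add: prime_elem_imp_coprime irreducible_imp_prime_elem)
  then obtain u v where "u * g + v * p = 1"
    by (metis bezout_coefficients_fst_snd coprime_imp_gcd_eq_1)
  then have "rpoly (u * g + v * p) z = 1" by simp
  then have "rpoly v z * x = 1" using g(2) p by simp
  then have "inverse x = rpoly v z"
    by (metis inverse_unique mult.commute)
  then show "inverse x \<in> adjoin z" by (auto simp: adjoin_def)
qed

text \<open>The factor \<open>w\<close> is there for the induction: splitting off the first power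
  replaces \<open>w\<close> by \<open>z * w\<close>. The application has \<open>w = 1\<close>, and
  the literal factor 1 in \<open>Us\<close> below keeps this shape.\<close>

lemma combine_powers:
  "CR.combine (map of_rat cs) (map (\<lambda>i. z ^ i * w) [0..<n]) = w * rpoly (Poly (take n cs)) z"
proof (induction n arbitrary: cs w)
  case (Suc n)
  have eq: "map (\<lambda>i. z ^ i * w) [0..<Suc n] = w # map (\<lambda>i. z ^ i * (z * w)) [0..<n]"
    by (simp only: map_upt_Suc) (simp add: mult_ac)
  show ?case
    by (cases cs) (simp_all only: eq list.map CR.combine.simps Suc, simp_all add: algebra_simps)
qed simp

lemma Rats_listE:
  assumes "set Ks \<subseteq> (\<rat> :: complex set)"
  obtains cs where "Ks = map of_rat cs"
proof -
  have "\<exists>cs. Ks = map of_rat cs"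
    using assms by (auto simp: ex_map_conv Rats_def)
  then show ?thesis using that by blast
qed

text \<open>The powers of \<open>z\<close> below \<open>degree g\<close> are independent because
  \<open>g\<close> divides every rational polynomial vanishing at \<open>z\<close>; they span by
  division with remainder by \<open>g\<close>.\<close>

lemma dimension_adjoin:
  assumes g: "irreducible g" "rpoly g z = 0"
  shows "CR.dimension (degree g) \<rat> (adjoin z)"
proof -
  define Us where "Us = map (\<lambda>i. z ^ i * 1) [0..<degree g]"
  have "CR.independent \<rat> Us"
  proof (rule CR.trivial_combine_imp_independent[OF subfield_Rats])
    fix Ks assume Ks: "set Ks \<subseteq> \<rat>" "CR.combine Ks Us = \<zero>\<^bsub>complex_ring\<^esub>"
    then obtain cs where cs: "Ks = map of_rat cs" using Rats_listE by blast
    define q where "q = Poly (take (degree g) cs)"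
    have "rpoly q z = 0"
      using Ks(2) unfolding cs Us_def combine_powers q_def by simp
    then have "g dvd q" using g by (rule_tac irreducible_dvd_if_common_root)
    moreover have "q = 0 \<or> degree q < degree g"
    proof (cases "q = 0")
      case False
      then have "length (coeffs q) \<le> length (take (degree g) cs)"
        by (metis q_def coeffs_Poly length_append le_add1 split_strip_while_append)
      then show ?thesis using False by (simp add: length_coeffs_degree)
    qed simp
    ultimately have "q = 0" by (metis dvd_imp_degree_le not_less)
    then obtain n where "take (degree g) cs = replicate n 0"
      by (auto simp: q_def Poly_eq_0)
    then have "take (length Us) Ks = replicate n 0"
      by (simp add: cs Us_def take_map map_replicate_const)
    then show "set (take (length Us) Ks) \<subseteq> {\<zero>\<^bsub>complex_ring\<^esub>}"
      by auto
  qed simp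
  moreover have "CR.Span \<rat> Us = adjoin z"
  proof -
    have "CR.Span \<rat> Us = {CR.combine Ks Us | Ks. set Ks \<subseteq> \<rat>}"
      by (rule CR.Span_eq_combine_set[OF subfield_Rats]) simp
    also have "\<dots> = adjoin z"
    proof (intro equalityI subsetI)
      fix x assume "x \<in> {CR.combine Ks Us | Ks. set Ks \<subseteq> \<rat>}"
      then obtain cs where "x = CR.combine (map of_rat cs) Us" using Rats_listE by blast
      then show "x \<in> adjoin z" by (simp add: Us_def combine_powers adjoin_def del: mult_1_right)
    next
      fix x assume "x \<in> adjoin z"
      then obtain p where p: "x = rpoly p z" by (auto simp: adjoin_def)
      have "rpoly p z = rpoly (p div g) z * rpoly g z + rpoly (p mod g) z"
        by (metis div_mult_mod_eq rpoly_add rpoly_mult)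
      then have x: "x = rpoly (p mod g) z" using g(2) p by simp
      have "take (degree g) (coeffs (p mod g)) = coeffs (p mod g)"
      proof (cases "p mod g = 0")
        case False
        then have "degree (p mod g) < degree g"
          using g(1) by (intro degree_mod_less') auto
        with False show ?thesis by (simp add: length_coeffs_degree)
      qed simp
      then have "x = CR.combine (map of_rat (coeffs (p mod g))) Us"
        by (simp add: Us_def combine_powers x del: mult_1_right)
      moreover have "set (map of_rat (coeffs (p mod g))) \<subseteq> (\<rat> :: complex set)" by auto
      ultimately show "x \<in> {CR.combine Ks Us | Ks. set Ks \<subseteq> \<rat>}" by blast
    qed
    finally show ?thesis .
  qed
  moreover have "length Us = degree g" by (simp add: Us_def)
  ultimately show ?thesis using CR.dimension_independent by metis
qed

text \<open>Polynomials of \<open>HOL-Algebra\<close> are lists with the leading coefficient first,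
  so \<open>hd p\<close> lands at index \<open>length p - 1\<close>. The vanishing clause makes room
  for the next leading term in the induction.\<close>

lemma eval_list_as_poly:
  assumes "set p \<subseteq> (\<rat> :: complex set)"
  shows "\<exists>q. (\<forall>i. coeff q i \<in> \<rat>) \<and> (\<forall>i\<ge>length p. coeff q i = 0) \<and>
           (p \<noteq> [] \<longrightarrow> coeff q (length p - 1) = hd p) \<and> poly q x = CR.eval p x"
  using assms
proof (induction p)
  case Nil
  show ?case by (rule exI[of _ 0]) simp
next
  case (Cons a p)
  then obtain q where q: "\<forall>i. coeff q i \<in> \<rat>" "\<forall>i\<ge>length p. coeff q i = 0" "poly q x = CR.eval p x"
    by auto
  show ?case
    by (rule exI[of _ "q + monom a (length p)"])
       (use q Cons.prems in \<open>auto simp: poly_monom\<close>)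
qed

lemma algebraic_if_in_number_field:
  assumes "number_field F" "x \<in> F"
  shows "algebraic x"
proof -
  have F: "subring F complex_ring" "CR.finite_dimension \<rat> F"
    using assms(1) subfieldE(1) by (auto simp: number_field_def)
  have "(CR.algebraic over \<rat>) x"
    using CR.finite_dimension_imp_algebraic[OF subfield_Rats F assms(2)] .
  then obtain p where p: "p \<in> carrier (\<rat> [X]\<^bsub>complex_ring\<^esub>)" "p \<noteq> []" "CR.eval p x = 0"
    using CR.algebraicE[OF subfieldE(1)[OF subfield_Rats], of x] by auto
  then have sp: "set p \<subseteq> \<rat>" "hd p \<noteq> 0"
    by (auto simp: univ_poly_def polynomial_def)
  obtain q where q: "\<forall>i. coeff q i \<in> \<rat>" "coeff q (length p - 1) = hd p" "poly q x = 0"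
    using eval_list_as_poly[OF sp(1), of x] p by auto
  have "q \<noteq> 0" using q(2) sp(2) by auto
  then show ?thesis using q by (intro algebraicI') auto
qed

lemma number_field_adjoin:
  assumes g: "irreducible g" "rpoly g z = 0"
  shows "number_field (adjoin z)" "degree_over_rat (adjoin z) = degree g"
proof -
  show "number_field (adjoin z)"
    unfolding number_field_def
    using subfield_adjoin[OF g] CR.finite_dimensionI[OF dimension_adjoin[OF g]] by simp
  show "degree_over_rat (adjoin z) = degree g"
    using CR.dimI[OF subfield_Rats dimension_adjoin[OF g]]
    by (simp add: degree_over_rat_def over_def)
qed

subsection \<open>Multiples of the origin on a Weierstrass curve\<close>

text \<open>
  On \<open>y\<^sup>2 + a\<^sub>1 x y + a\<^sub>3 y = x\<^sup>3 + a\<^sub>2 x\<^sup>2\<close> with \<open>P = (0, 0)\<close>, the pair at index \<open>m\<close> consists of the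
  abscissa \<open>x\<close> of \<open>(m + 2) P\<close> and of the slope \<open>y / x\<close> of the line joining that point to \<open>P\<close>.
\<close>

primrec multiple :: "'a::field \<Rightarrow> 'a \<Rightarrow> 'a \<Rightarrow> nat \<Rightarrow> 'a \<times> 'a" where
  "multiple a1 a2 a3 0 = (- a2, a3 / a2 - a1)"
| "multiple a1 a2 a3 (Suc m) =
     (let x = - a3 * snd (multiple a1 a2 a3 m) / fst (multiple a1 a2 a3 m)
      in (x, - snd (multiple a1 a2 a3 m) - a1 - a3 / x))"

abbreviation abscissa :: "'a::field \<Rightarrow> 'a \<Rightarrow> 'a \<Rightarrow> nat \<Rightarrow> 'a" where
  "abscissa a1 a2 a3 m \<equiv> fst (multiple a1 a2 a3 m)"

abbreviation slope :: "'a::field \<Rightarrow> 'a \<Rightarrow> 'a \<Rightarrow> nat \<Rightarrow> 'a" where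
  "slope a1 a2 a3 m \<equiv> snd (multiple a1 a2 a3 m)"

lemma abscissa_nonzero:
  assumes "a2 \<noteq> 0" "a3 \<noteq> 0" "\<forall>i<m. slope a1 a2 a3 i \<noteq> 0"
  shows "abscissa a1 a2 a3 m \<noteq> 0"
  using assms by (induction m) (simp_all add: Let_def)

text \<open>This is the curve equation at the point (x, l x), divided by x. Read as a quadratic in x
  for fixed l, its roots x and x' have product - a3 l, which is the recursion for the abscissa; the
  new slope is that of the reflected third point.\<close>

lemma multiple_on_curve:
  assumes "a2 \<noteq> 0" "a3 \<noteq> 0" "\<forall>i<m. slope a1 a2 a3 i \<noteq> 0"
  defines "x \<equiv> abscissa a1 a2 a3 m" and "l \<equiv> slope a1 a2 a3 m"
  shows "l ^ 2 * x + a1 * l * x + a3 * l = x ^ 2 + a2 * x"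
  using assms(3) unfolding x_def l_def
proof (induction m)
  case 0
  show ?case using assms(1) by (simp add: field_simps power2_eq_square)
next
  case (Suc m)
  define x l where "x = abscissa a1 a2 a3 m" and "l = slope a1 a2 a3 m"
  define x' where "x' = - a3 * l / x"
  have nz: "x \<noteq> 0" "x' \<noteq> 0" "l \<noteq> 0"
    using abscissa_nonzero[OF assms(1,2), of m a1] Suc.prems assms(2)
    by (auto simp: x_def l_def x'_def)
  have IH: "l ^ 2 * x + a1 * l * x + a3 * l = x ^ 2 + a2 * x"
    using Suc by (simp add: x_def l_def)
  have xx: "x * x' = - a3 * l" using nz(1) by (simp add: x'_def)
  have "x * x' = x * (l ^ 2 + a1 * l - a2 - x)"
    unfolding xx using IH by (simp add: algebra_simps power2_eq_square)
  then have x': "x' = l ^ 2 + a1 * l - a2 - x" using nz(1) by simp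
  have curve: "l ^ 2 * x' + a1 * l * x' + a3 * l = x' ^ 2 + a2 * x'"
  proof -
    have "l ^ 2 * x' + a1 * l * x' + a3 * l - (x' ^ 2 + a2 * x') =
        x' * (l ^ 2 + a1 * l - a2 - x - x') + (x * x' + a3 * l)"
      by (simp add: algebra_simps power2_eq_square)
    also have "\<dots> = 0" using x' xx by simp
    finally show ?thesis by simp
  qed
  define l' where "l' = - l - a1 - a3 / x'"
  have l': "l' * x' = - l * x' - a1 * x' - a3"
    using nz(2) by (simp add: l'_def field_simps)
  have "l' ^ 2 * x' + a1 * l' * x' + a3 * l' = l' * (l' * x' + a1 * x' + a3)"
    by (simp add: algebra_simps power2_eq_square)
  also have "l' * x' + a1 * x' + a3 = - l * x'"
    using l' by simp
  also have "l' * (- l * x') = - l * (l' * x')"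
    by simp
  also have "\<dots> = x' ^ 2 + a2 * x'"
    unfolding l' using curve by (simp add: algebra_simps power2_eq_square)
  finally show ?case
    by (simp add: Let_def x_def l_def x'_def l'_def)
qed

text \<open>The other Vieta relation: the recursion uses the product of the two roots,
  \<open>point_add\<close> their sum.\<close>

lemma abscissa_Suc:
  assumes "a2 \<noteq> 0" "a3 \<noteq> 0" "\<forall>i<m. slope a1 a2 a3 i \<noteq> 0"
  shows "abscissa a1 a2 a3 (Suc m) =
    slope a1 a2 a3 m ^ 2 + a1 * slope a1 a2 a3 m - a2 - abscissa a1 a2 a3 m"
  using abscissa_nonzero[OF assms] multiple_on_curve[OF assms]
  by (simp add: Let_def field_simps power2_eq_square)

lemma multiple_of_origin:
  fixes a1 a2 a3 :: "'a::field"
  assumes "a2 \<noteq> 0" "a3 \<noteq> 0" "\<forall>i<m. slope a1 a2 a3 i \<noteq> 0"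
  defines "x \<equiv> abscissa a1 a2 a3 m" and "l \<equiv> slope a1 a2 a3 m"
  shows "Affine 0 0 [^]\<^bsub>point_group F (Weierstrass a1 a2 a3 0 0)\<^esub> (m + 2) = Affine x (l * x)"
  using assms(3) unfolding x_def l_def
proof (induction m)
  case 0
  show ?case using assms(1,2)
    by (simp add: point_group_def numeral_2_eq_2 Let_def field_simps)
next
  case (Suc m)
  have nz: "abscissa a1 a2 a3 m \<noteq> 0" "abscissa a1 a2 a3 (Suc m) \<noteq> 0"
    by (rule abscissa_nonzero; use assms(1,2) Suc.prems in auto)+
  have "\<forall>i<m. slope a1 a2 a3 i \<noteq> 0" using Suc.prems by auto
  note IH = Suc.IH[OF this] and x' = abscissa_Suc[OF assms(1,2) this]
  define x l where "x = abscissa a1 a2 a3 m" and "l = slope a1 a2 a3 m"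
  define x' where "x' = abscissa a1 a2 a3 (Suc m)"
  have "slope a1 a2 a3 (Suc m) * x' = - l * x' - a1 * x' - a3"
    using nz(2) by (simp add: l_def x'_def Let_def field_simps)
  moreover have "point_add (Weierstrass a1 a2 a3 0 0) (Affine x (l * x)) (Affine 0 0) =
      Affine x' (l * (x - x') - l * x - a1 * x' - a3)"
    using nz(1) x' by (simp add: Let_def x_def[symmetric] l_def[symmetric] x'_def)
  ultimately show ?case
    using IH by (simp add: point_group_def x_def l_def x'_def algebra_simps)
qed

text \<open>Slope 0 means that the line through P and (m + 2) P is y = 0, the tangent at P. It meets
  the curve twice in P, so (m + 3) P = - P. All earlier multiples are affine.\<close>

lemma has_order_origin:
  fixes a1 a2 a3 :: "'a::field"
  assumes "a2 \<noteq> 0" "a3 \<noteq> 0" "\<forall>i<m. slope a1 a2 a3 i \<noteq> 0" "slope a1 a2 a3 m = 0"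
  shows "has_order (point_group F (Weierstrass a1 a2 a3 0 0)) (Affine 0 0) (m + 4)"
proof -
  let ?G = "point_group F (Weierstrass a1 a2 a3 0 0)"
  let ?P = "Affine 0 0 :: 'a point"
  have pow_Suc: "?P [^]\<^bsub>?G\<^esub> Suc n = point_add (Weierstrass a1 a2 a3 0 0) (?P [^]\<^bsub>?G\<^esub> n) ?P" for n
    by (simp add: point_group_def)
  have m2: "?P [^]\<^bsub>?G\<^esub> (m + 2) = Affine (abscissa a1 a2 a3 m) 0"
    using multiple_of_origin[OF assms(1-3)] assms(4) by simp
  have x': "0 = - a2 - abscissa a1 a2 a3 m"
    using abscissa_Suc[OF assms(1-3)] assms(4) by (simp add: Let_def)
  have m3: "?P [^]\<^bsub>?G\<^esub> (m + 3) = Affine 0 (- a3)"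
    using pow_Suc[of "m + 2"] m2 x' abscissa_nonzero[OF assms(1-3)]
    by (simp add: Let_def numeral_3_eq_3)
  have m4: "?P [^]\<^bsub>?G\<^esub> (m + 4) = Infinity"
    using pow_Suc[of "m + 3"] m3 by (simp add: eval_nat_numeral)
  have "?P [^]\<^bsub>?G\<^esub> n \<noteq> Infinity" if "0 < n" "n < m + 4" for n
  proof -
    consider "n = 1" | "2 \<le> n" "n \<le> m + 2" | "n = m + 3"
      using \<open>0 < n\<close> \<open>n < m + 4\<close> by linarith
    then show ?thesis
    proof cases
      case 1
      then show ?thesis by (simp add: point_group_def)
    next
      case 2
      then obtain i where "n = i + 2" "i \<le> m" by (metis add.commute add_le_cancel_left le_Suc_ex)
      then show ?thesis using multiple_of_origin[OF assms(1,2), of i a1 F] assms(3) by simp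
    next
      case 3
      then show ?thesis using m3 by simp
    qed
  qed
  then show ?thesis
    using m4 by (auto simp: has_order_def point_group_def)
qed

subsection \<open>Degeneration to a nodal cubic\<close>

text \<open>
  With the quantum integers \<open>[n]\<close> and \<open>t = 1 / [2]\<^sup>2\<close>, the following is \<open>[n] / [2]\<^sup>n\<^sup>-\<^sup>1\<close>. The smooth
  points of the nodal cubic form a multiplicative group, whence the closed forms below.
\<close>

fun qfib :: "nat \<Rightarrow> real \<Rightarrow> real" where
  "qfib 0 t = 0"
| "qfib (Suc 0) t = 1"
| "qfib (Suc (Suc n)) t = qfib (Suc n) t - t * qfib n t"

definition nodal_abscissa :: "nat \<Rightarrow> real \<Rightarrow> real" where
  "nodal_abscissa m t = - t * qfib (m + 1) t * qfib (m + 3) t / qfib (m + 2) t ^ 2"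

definition nodal_slope :: "nat \<Rightarrow> real \<Rightarrow> real" where
  "nodal_slope m t = - t * qfib (m + 1) t * qfib (m + 4) t / (qfib (m + 2) t * qfib (m + 3) t)"

lemma tendsto_qfib: "(qfib (Suc n) \<longlongrightarrow> 1) (at 0)"
proof (induction n rule: induct_nat_012)
  case 1
  have "((\<lambda>t. 1 - t * 0) \<longlongrightarrow> 1 - 0 * 0) (at (0::real))" by (intro tendsto_intros)
  then show ?case by simp
next
  case (ge2 n)
  have "((\<lambda>t. qfib (Suc (Suc n)) t - t * qfib (Suc n) t) \<longlongrightarrow> 1 - 0 * 1) (at (0::real))"
    by (intro tendsto_intros ge2)
  then show ?case by simp
qed simp

lemma eventually_qfib_nonzero: "eventually (\<lambda>t. qfib (n + numeral k) t \<noteq> 0) (at 0)"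
    "eventually (\<lambda>t. qfib (n + 1) t \<noteq> 0) (at 0)"
  using tendsto_imp_eventually_ne[OF tendsto_qfib[of "n + pred_numeral k"], of 0]
    tendsto_imp_eventually_ne[OF tendsto_qfib[of n], of 0]
  by (simp_all add: numeral_eq_Suc)

lemma tendsto_qfib': "(qfib (n + numeral k) \<longlongrightarrow> 1) (at 0)" "(qfib (n + 1) \<longlongrightarrow> 1) (at 0)"
  using tendsto_qfib[of "n + pred_numeral k"] tendsto_qfib[of n]
  by (simp_all add: numeral_eq_Suc)

lemma tendsto_at_0_transform:
  fixes f g :: "real \<Rightarrow> real"
  assumes "(f \<longlongrightarrow> l) (at 0)" "\<And>t. t \<noteq> 0 \<Longrightarrow> f t = g t"
  shows "(g \<longlongrightarrow> l) (at 0)"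
  using assms by (intro Lim_transform_eventually[OF assms(1)]) (simp add: eventually_at_filter)

lemma eventually_nonzero_at_0: "eventually (\<lambda>t. t \<noteq> (0::real)) (at 0)"
  by (simp add: eventually_at_filter)

lemma tendsto_nodal_abscissa: "((\<lambda>t. nodal_abscissa m t / t) \<longlongrightarrow> - 1) (at 0)"
proof -
  have "((\<lambda>t. - (qfib (m + 1) t * qfib (m + 3) t / qfib (m + 2) t ^ 2)) \<longlongrightarrow> - (1 * 1 / 1 ^ 2)) (at 0)"
    by (intro tendsto_intros tendsto_qfib') simp
  then show ?thesis
    by (rule tendsto_at_0_transform[THEN tendsto_eq_rhs]) (simp_all add: nodal_abscissa_def)
qed

lemma tendsto_nodal_slope: "((\<lambda>t. nodal_slope m t / t) \<longlongrightarrow> - 1) (at 0)"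
proof -
  have "((\<lambda>t. - (qfib (m + 1) t * qfib (m + 4) t / (qfib (m + 2) t * qfib (m + 3) t))) \<longlongrightarrow> - (1 * 1 / (1 * 1))) (at 0)"
    by (intro tendsto_intros tendsto_qfib') simp
  then show ?thesis
    by (rule tendsto_at_0_transform[THEN tendsto_eq_rhs]) (simp_all add: nodal_slope_def)
qed

lemma nodal_recursion:
  assumes "t \<noteq> 0" "qfib (m + 1) t \<noteq> 0" "qfib (m + 2) t \<noteq> 0" "qfib (m + 3) t \<noteq> 0" "qfib (m + 4) t \<noteq> 0"
  shows "nodal_abscissa (Suc m) t = - t * nodal_slope m t / nodal_abscissa m t"
    "nodal_slope (Suc m) t = - nodal_slope m t - (1 + 2 * t) - t / nodal_abscissa (Suc m) t"
proof -
  show "nodal_abscissa (Suc m) t = - t * nodal_slope m t / nodal_abscissa m t"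
    using assms by (simp add: nodal_abscissa_def nodal_slope_def eval_nat_numeral field_simps del: qfib.simps)
  define a b c d where "a = qfib (m + 1) t" and "b = qfib (m + 2) t" and "c = qfib (m + 3) t" and "d = qfib (m + 4) t"
  have rec: "c = b - t * a" "d = c - t * b" and e: "qfib (m + 5) t = d - t * c"
    by (simp_all add: a_def b_def c_def d_def eval_nat_numeral)
  have nz: "a \<noteq> 0" "b \<noteq> 0" "c \<noteq> 0" "d \<noteq> 0" using assms by (simp_all add: a_def b_def c_def d_def)
  have idx: "Suc m + 1 = m + 2" "Suc m + 2 = m + 3" "Suc m + 3 = m + 4" "Suc m + 4 = m + 5" by simp_all
  have x: "t / nodal_abscissa (Suc m) t = - (c ^ 2 / (b * d))"
    using assms(1) nz unfolding nodal_abscissa_def idx b_def[symmetric] c_def[symmetric] d_def[symmetric]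
    by simp
  have l: "nodal_slope m t = - t * a * d / (b * c)"
    by (simp only: nodal_slope_def a_def b_def c_def d_def)
  have l': "nodal_slope (Suc m) t = - t * b * (d - t * c) / (c * d)"
    unfolding nodal_slope_def idx e by (simp only: b_def c_def d_def)
  \<comment> \<open>After c and d are eliminated through the recurrence of \<open>qfib\<close>, this
    is an identity in a, b and t alone.\<close>
  have poly: "- t * b ^ 2 * (d - t * c) = t * a * d ^ 2 - (1 + 2 * t) * (b * c * d) + c ^ 3"
    unfolding rec by (simp add: algebra_simps power2_eq_square power3_eq_cube)
  have "- t * b * (d - t * c) / (c * d) = - t * b ^ 2 * (d - t * c) / (b * c * d)"
    using nz by (simp add: field_simps power2_eq_square)
  also have "\<dots> = t * a * d / (b * c) - (1 + 2 * t) + c ^ 2 / (b * d)"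
    unfolding poly using nz by (simp add: field_simps power2_eq_square power3_eq_cube)
  finally show "nodal_slope (Suc m) t = - nodal_slope m t - (1 + 2 * t) - t / nodal_abscissa (Suc m) t"
    unfolding x l l' by simp
qed

text \<open>Here \<open>K = N - 4\<close>, so that index \<open>K\<close> belongs to \<open>(N - 2) P\<close>.\<close>

definition perturbed_abscissa :: "nat \<Rightarrow> real \<Rightarrow> nat \<Rightarrow> real \<Rightarrow> real" where
  "perturbed_abscissa K r m t = abscissa (1 + 2 * t + r * t ^ (K + 1)) (t * (1 - t)) t m"

definition perturbed_slope :: "nat \<Rightarrow> real \<Rightarrow> nat \<Rightarrow> real \<Rightarrow> real" where
  "perturbed_slope K r m t = slope (1 + 2 * t + r * t ^ (K + 1)) (t * (1 - t)) t m"

lemma perturbed_0: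
  "perturbed_abscissa K r 0 t = - (t * (1 - t))"
  "perturbed_slope K r 0 t = t / (t * (1 - t)) - (1 + 2 * t + r * t ^ (K + 1))"
  by (simp_all add: perturbed_abscissa_def perturbed_slope_def)

lemma perturbed_Suc:
  "perturbed_abscissa K r (Suc m) t = - t * perturbed_slope K r m t / perturbed_abscissa K r m t"
  "perturbed_slope K r (Suc m) t =
     - perturbed_slope K r m t - (1 + 2 * t + r * t ^ (K + 1)) - t / perturbed_abscissa K r (Suc m) t"
  by (simp_all add: perturbed_abscissa_def perturbed_slope_def Let_def)

text \<open>The abscissa of 2 P is - a2 and does not see a1. The slope changes by - r t^(K + 1) and
  has size t, whence the relative error of order t^K.\<close>

lemma perturbation_base:
  "((\<lambda>t. (perturbed_slope K r 0 t / nodal_slope 0 t - 1) / t ^ K) \<longlongrightarrow> r) (at 0)"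
  "((\<lambda>t. (perturbed_abscissa K r 0 t / nodal_abscissa 0 t - 1) / t ^ K) \<longlongrightarrow> 0) (at 0)"
proof -
  have ev: "eventually (\<lambda>t::real. t \<noteq> 0 \<and> 1 - t \<noteq> 0 \<and> 1 - 2 * t \<noteq> 0) (at 0)"
    by (intro eventually_conj eventually_nonzero_at_0 tendsto_imp_eventually_ne[where c = "1::real"])
       (auto intro!: tendsto_eq_intros)
  have qf: "qfib (Suc 0) t = 1" "qfib 2 t = 1" "qfib 3 t = 1 - t" "qfib 4 t = 1 - 2 * t" for t
    by (simp_all add: eval_nat_numeral)
  have "((\<lambda>t. r * ((1 - t) / (1 - 2 * t))) \<longlongrightarrow> r * ((1 - 0) / (1 - 2 * 0))) (at (0::real))"
    by (intro tendsto_intros) simp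
  moreover have "eventually (\<lambda>t. r * ((1 - t) / (1 - 2 * t)) = (perturbed_slope K r 0 t / nodal_slope 0 t - 1) / t ^ K) (at 0)"
    using ev
  proof eventually_elim
    case (elim t)
    have "perturbed_slope K r 0 t = nodal_slope 0 t - r * t ^ (K + 1)"
      using elim by (simp add: perturbed_0 nodal_slope_def qf field_simps)
    moreover have "nodal_slope 0 t \<noteq> 0" "nodal_slope 0 t = - t * (1 - 2 * t) / (1 - t)"
      using elim by (simp_all add: nodal_slope_def qf)
    ultimately have "perturbed_slope K r 0 t / nodal_slope 0 t - 1 = - (r * t ^ (K + 1)) / (- t * (1 - 2 * t) / (1 - t))"
      by (metis diff_divide_distrib diff_add_cancel add_diff_cancel_left' divide_self
          minus_divide_left uminus_add_conv_diff)
    then show ?case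
      using elim by simp
  qed
  ultimately show "((\<lambda>t. (perturbed_slope K r 0 t / nodal_slope 0 t - 1) / t ^ K) \<longlongrightarrow> r) (at 0)"
    using Lim_transform_eventually by force
  have "eventually (\<lambda>t. 0 = (perturbed_abscissa K r 0 t / nodal_abscissa 0 t - 1) / t ^ K) (at 0)"
    using ev by eventually_elim (simp add: perturbed_0 nodal_abscissa_def qf)
  then show "((\<lambda>t. (perturbed_abscissa K r 0 t / nodal_abscissa 0 t - 1) / t ^ K) \<longlongrightarrow> 0) (at 0)"
    by (rule Lim_transform_eventually[OF tendsto_const])
qed

text \<open>With U and V the ratios of perturbed to nodal abscissa and slope, the next U is V / U,
  so its error is that of V to leading order. The next slope contains t / x', which is larger than
  the slope by a factor of order 1 / t. Each step thus costs one power of t and preserves the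
  leading coefficient r.\<close>

lemma perturbation:
  assumes "m \<le> K"
  shows "((\<lambda>t. (perturbed_slope K r m t / nodal_slope m t - 1) / t ^ (K - m)) \<longlongrightarrow> r) (at 0) \<and>
    ((\<lambda>t. (perturbed_abscissa K r m t / nodal_abscissa m t - 1) / t ^ (K - m)) \<longlongrightarrow> 0) (at 0)"
  using assms
proof (induction m)
  case 0
  show ?case using perturbation_base by simp
next
  case (Suc m)
  define e where "e = K - m"
  have e: "e = Suc (K - Suc m)" "K + 1 = m + 1 + e" using Suc.prems by (simp_all add: e_def)
  define U V U' V' where "U = (\<lambda>t. perturbed_abscissa K r m t / nodal_abscissa m t)" and "V = (\<lambda>t. perturbed_slope K r m t / nodal_slope m t)"
    and "U' = (\<lambda>t. perturbed_abscissa K r (Suc m) t / nodal_abscissa (Suc m) t)"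
    and "V' = (\<lambda>t. perturbed_slope K r (Suc m) t / nodal_slope (Suc m) t)"
  define A B A' where "A = (\<lambda>t. (U t - 1) / t ^ e)" and "B = (\<lambda>t. (V t - 1) / t ^ e)"
    and "A' = (\<lambda>t. (B t - A t) / U t)"
  have IH: "(B \<longlongrightarrow> r) (at 0)" "(A \<longlongrightarrow> 0) (at 0)"
    using Suc by (simp_all add: A_def B_def U_def V_def e_def)
  have te: "((\<lambda>t::real. t ^ e) \<longlongrightarrow> 0) (at 0)"
    using e(1) by (auto intro!: tendsto_eq_intros)
  have "((\<lambda>t. 1 + A t * t ^ e) \<longlongrightarrow> 1 + 0 * 0) (at 0)" by (intro tendsto_intros IH te)
  then have limU: "(U \<longlongrightarrow> 1) (at 0)"
    by (rule tendsto_at_0_transform[THEN tendsto_eq_rhs]) (simp_all add: A_def)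
  then have evU: "eventually (\<lambda>t. U t \<noteq> 0) (at 0)"
    by (rule tendsto_imp_eventually_ne) simp
  have "(A' \<longlongrightarrow> (r - 0) / 1) (at 0)" unfolding A'_def by (intro tendsto_intros IH limU) simp
  then have limA': "(A' \<longlongrightarrow> r) (at 0)" by simp
  have ev: "eventually (\<lambda>t. t \<noteq> 0 \<and> U t \<noteq> 0 \<and> qfib (m + 1) t \<noteq> 0 \<and> qfib (m + 2) t \<noteq> 0 \<and>
      qfib (m + 3) t \<noteq> 0 \<and> qfib (m + 4) t \<noteq> 0 \<and> qfib (m + 5) t \<noteq> 0) (at 0)"
    by (intro eventually_conj eventually_nonzero_at_0 evU eventually_qfib_nonzero)
  have evU': "eventually (\<lambda>t. U' t = 1 + A' t * t ^ e) (at 0)"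
    using ev
  proof eventually_elim
    case (elim t)
    have nz: "nodal_abscissa m t \<noteq> 0" "nodal_slope m t \<noteq> 0"
      using elim by (simp_all add: nodal_abscissa_def nodal_slope_def)
    have "perturbed_abscissa K r m t = U t * nodal_abscissa m t" "perturbed_slope K r m t = V t * nodal_slope m t"
      using nz by (simp_all add: U_def V_def)
    then have "perturbed_abscissa K r (Suc m) t = - t * (V t * nodal_slope m t) / (U t * nodal_abscissa m t)"
      by (simp add: perturbed_Suc)
    then have "U' t = V t / U t"
      using elim nz nodal_recursion(1)[of t m] by (simp add: U'_def)
    then show ?case
      using elim by (simp add: A'_def A_def B_def field_simps)
  qed
  have "((\<lambda>t. 1 + A' t * t ^ e) \<longlongrightarrow> 1 + r * 0) (at 0)" by (intro tendsto_intros limA' te)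
  then have limU': "(U' \<longlongrightarrow> 1) (at 0)"
    using Lim_transform_eventually[of "\<lambda>t. 1 + A' t * t ^ e" 1 "at 0" U'] evU'
    by (simp add: eq_commute)
  then have evU'0: "eventually (\<lambda>t. U' t \<noteq> 0) (at 0)"
    by (rule tendsto_imp_eventually_ne) simp
  \<comment> \<open>The abscissa at \<open>Suc m\<close> still has an error of order t^e, one power
    of t better than the normalisation demands.\<close>
  have "((\<lambda>t. A' t * t) \<longlongrightarrow> r * 0) (at 0)" by (intro tendsto_intros limA')
  moreover have "eventually (\<lambda>t. A' t * t = (U' t - 1) / t ^ (K - Suc m)) (at 0)"
    using ev evU' by eventually_elim (simp add: e(1))
  ultimately have 1: "((\<lambda>t. (U' t - 1) / t ^ (K - Suc m)) \<longlongrightarrow> 0) (at 0)"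
    using Lim_transform_eventually by force
  have inv_lim: "((\<lambda>t. t / f t) \<longlongrightarrow> - 1) (at 0)" if "((\<lambda>t. f t / t) \<longlongrightarrow> - 1) (at 0)" for f :: "real \<Rightarrow> real"
    using tendsto_inverse[OF that] by simp
  \<comment> \<open>Of the three summands only the error of t / x' survives in the limit. The old
    slope appears as a quotient by t times t, since only the limit of the quotient is at
    hand.\<close>
  have "((\<lambda>t. t / nodal_slope (Suc m) t * (- (nodal_slope m t / t * t) * B t - r * t ^ (m + 1)
      + t / nodal_abscissa (Suc m) t * (A' t / U' t))) \<longlongrightarrow> - 1 * (- (- 1 * 0) * r - r * 0 ^ (m + 1) + - 1 * (r / 1))) (at 0)"
    by (intro tendsto_intros inv_lim tendsto_nodal_slope tendsto_nodal_abscissa IH limA' limU') simp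
  moreover have "eventually (\<lambda>t. t / nodal_slope (Suc m) t * (- (nodal_slope m t / t * t) * B t - r * t ^ (m + 1)
      + t / nodal_abscissa (Suc m) t * (A' t / U' t)) = (V' t - 1) / t ^ (K - Suc m)) (at 0)"
    using ev evU' evU'0
  proof eventually_elim
    case (elim t)
    define x' l' l where "x' = nodal_abscissa (Suc m) t" and "l' = nodal_slope (Suc m) t" and "l = nodal_slope m t"
    have nz: "x' \<noteq> 0" "l' \<noteq> 0" "l \<noteq> 0"
      using elim by (simp_all add: x'_def l'_def l_def nodal_abscissa_def nodal_slope_def add.commute add.left_commute
          del: qfib.simps) (simp_all add: eval_nat_numeral del: qfib.simps)
    have ab': "perturbed_abscissa K r (Suc m) t = U' t * x'" and sl: "perturbed_slope K r m t = V t * l"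
      using nz by (simp_all add: U'_def V_def x'_def l_def)
    have V: "V t = 1 + B t * t ^ e" using elim by (simp add: B_def)
    have "perturbed_slope K r (Suc m) t = - perturbed_slope K r m t - (1 + 2 * t + r * t ^ (K + 1)) - t / perturbed_abscissa K r (Suc m) t"
      by (simp add: perturbed_Suc)
    then have "perturbed_slope K r (Suc m) t = - (V t * l) - (1 + 2 * t + r * t ^ (K + 1)) - t / x' / U' t"
      unfolding ab' sl by simp
    moreover have "U' t \<noteq> 0" using elim by blast
    then have "t / x' / U' t = t / x' - t / x' * ((U' t - 1) / U' t)"
      using nz(1) by (simp add: field_simps)
    moreover have "l' = - l - (1 + 2 * t) - t / x'"
      using nodal_recursion(2)[of t m] elim unfolding l'_def l_def x'_def by blast
    ultimately have "perturbed_slope K r (Suc m) t - l' =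
        - l * (V t - 1) - r * t ^ (K + 1) + t / x' * ((U' t - 1) / U' t)"
      by (simp only:) (simp add: algebra_simps)
    also have "U' t - 1 = A' t * t ^ e" using elim by simp
    also have "V t - 1 = B t * t ^ e" by (simp add: V)
    also have "t ^ (K + 1) = t ^ (m + 1) * t ^ e" by (simp only: e(2) power_add)
    finally have "perturbed_slope K r (Suc m) t - l' = t ^ e * (- l * B t - r * t ^ (m + 1) + t / x' * (A' t / U' t))"
      by (simp add: algebra_simps)
    then have "V' t - 1 = t ^ e * (- l * B t - r * t ^ (m + 1) + t / x' * (A' t / U' t)) / l'"
      using nz by (simp add: V'_def l'_def[symmetric] field_simps)
    then have "(V' t - 1) / t ^ (K - Suc m) = t / l' * (- (l / t * t) * B t - r * t ^ (m + 1) + t / x' * (A' t / U' t))"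
      using elim by (simp add: e(1))
    then show ?case by (simp add: x'_def l'_def l_def)
  qed
  ultimately have 2: "((\<lambda>t. (V' t - 1) / t ^ (K - Suc m)) \<longlongrightarrow> r) (at 0)"
    using Lim_transform_eventually by force
  show ?case using 1 2 by (simp add: U'_def V'_def)
qed

subsection \<open>Plane curves over the rational numbers\<close>

text \<open>
  Polynomials in two variables \<open>t\<close> and \<open>r\<close> are polynomials in \<open>r\<close> whose coefficients are
  polynomials in \<open>t\<close>.
\<close>

definition bpoly :: "rat poly poly \<Rightarrow> 'a::field_char_0 \<Rightarrow> 'a \<Rightarrow> 'a" where
  "bpoly H t r = poly (map_poly (\<lambda>q. rpoly q t) H) r"

lemma bpoly_0 [simp]: "bpoly 0 t r = 0"
  and bpoly_pCons [simp]: "bpoly (pCons q H) t r = rpoly q t + r * bpoly H t r"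
  by (simp_all add: bpoly_def map_poly_pCons)

lemma bpoly_1 [simp]: "bpoly 1 t r = 1"
  by (simp add: one_pCons)

lemma bpoly_add [simp]: "bpoly (G + H) t r = bpoly G t r + bpoly H t r"
  unfolding bpoly_def by (rule poly_map_poly_add) simp_all

lemma bpoly_mult [simp]: "bpoly (G * H) t r = bpoly G t r * bpoly H t r"
  unfolding bpoly_def by (rule poly_map_poly_mult) simp_all

lemma bpoly_minus [simp]: "bpoly (- H) t r = - bpoly H t r"
  using bpoly_add[of H "- H" t r] by (simp add: eq_neg_iff_add_eq_0 add.commute)

lemma bpoly_diff [simp]: "bpoly (G - H) t r = bpoly G t r - bpoly H t r"
  using bpoly_add[of G "- H" t r] by simp

lemma bpoly_power [simp]: "bpoly (H ^ n) t r = bpoly H t r ^ n"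
  by (induction n) simp_all

lemma bpoly_numeral [simp]: "bpoly (numeral n) t r = numeral n"
  by (simp add: numeral_poly)

lemma bpoly_sum: "bpoly (\<Sum>i\<in>A. f i) t r = (\<Sum>i\<in>A. bpoly (f i) t r)"
  by (induction A rule: infinite_finite_induct) simp_all

text \<open>The roots of \<open>poly H q\<close> are thus the t-coordinates of the intersections of
  H = 0 with the graph r = q(t).\<close>

lemma rpoly_poly: "rpoly (poly H q) t = bpoly H t (rpoly q t)"
  by (induction H) simp_all

section \<open>Irreducible factors of rational polynomials\<close>

lemma irreducible_factor_with_root:
  fixes q :: "rat poly" and t :: "'a::field_char_0"
  assumes "q \<noteq> 0" "rpoly q t = 0"
  obtains \<mu> where "irreducible \<mu>" "\<mu> dvd q" "rpoly \<mu> t = 0"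
proof -
  have "\<exists>\<mu>. irreducible \<mu> \<and> \<mu> dvd q \<and> rpoly \<mu> t = 0"
    using assms
  proof (induction q rule: prime_divisors_induct)
    case (unit q)
    then show ?case using rpoly_root_unit by blast
  next
    case (factor p q)
    then have "irreducible p" by (blast intro: prime_elem_imp_irreducible prime_imp_prime_elem)
    with factor show ?case
      by (cases "rpoly p t = 0") (auto intro: dvd_mult)
  qed simp
  then show ?thesis using that by blast
qed

text \<open>The degrees of the irreducible factors, with multiplicity, add up to
  \<open>degree q\<close>, so they cannot all be divisible by \<open>p\<close>.\<close>

lemma irreducible_factor_degree:
  fixes q :: "rat poly"
  assumes "\<not> p dvd degree q" "q \<noteq> 0"
  obtains \<mu> where "irreducible \<mu>" "\<mu> dvd q" "\<not> p dvd degree \<mu>"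
proof -
  have "\<exists>\<mu>. irreducible \<mu> \<and> \<mu> dvd q \<and> \<not> p dvd degree \<mu>"
    using assms
  proof (induction q rule: prime_divisors_induct)
    case (unit q)
    then show ?case by (auto simp: is_unit_poly_iff)
  next
    case (factor g q)
    then have "degree (g * q) = degree g + degree q" by (intro degree_mult_eq) auto
    moreover have "irreducible g"
      using factor by (blast intro: prime_elem_imp_irreducible prime_imp_prime_elem)
    moreover have "\<not> p dvd degree q" if "p dvd degree g"
      using factor.prems(1) calculation(1) that by (simp add: dvd_add_right_iff)
    ultimately show ?case
      using factor by (cases "p dvd degree g") (auto intro: dvd_mult)
  qed simp
  then show ?thesis using that by blast
qed

section \<open>Restriction to the line t = 0\<close>

definition fibre0 :: "rat poly poly \<Rightarrow> rat poly" where
  "fibre0 H = map_poly (\<lambda>q. poly q 0) H"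

lemma fibre0_0 [simp]: "fibre0 0 = 0"
  and fibre0_pCons [simp]: "fibre0 (pCons q H) = pCons (poly q 0) (fibre0 H)"
  by (simp_all add: fibre0_def map_poly_pCons)

lemma fibre0_mult: "fibre0 (G * H) = fibre0 G * fibre0 H"
proof -
  have "poly (fibre0 (G * H)) x = poly (fibre0 G * fibre0 H) x" for x
    unfolding fibre0_def poly_mult by (rule poly_map_poly_mult) simp_all
  then show ?thesis by (simp add: poly_eq_poly_eq_iff[symmetric] fun_eq_iff)
qed

lemma bpoly_at_0: "bpoly H 0 r = rpoly (fibre0 H) r"
proof -
  have "rpoly q (0::'a) = of_rat (poly q 0)" for q
    using rpoly_of_rat[of q 0, where 'a = 'a] by simp
  then show ?thesis by (induction H) simp_all
qed

text \<open>The variable t is \<open>[:[:0, 1:]:]\<close>, a constant with respect to r; the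
  variable r is \<open>[:0, 1:]\<close>.\<close>

lemma fibre0_eq_0_iff: "fibre0 H = 0 \<longleftrightarrow> [:[:0, 1:]:] dvd H"
proof -
  have "fibre0 H = 0 \<longleftrightarrow> (\<forall>n. poly (coeff H n) 0 = 0)"
    by (simp add: poly_eq_iff fibre0_def coeff_map_poly)
  also have "\<dots> \<longleftrightarrow> (\<forall>n. [:0, 1:] dvd coeff H n)"
    by (simp add: poly_eq_0_iff_dvd)
  finally show ?thesis by (simp add: const_poly_dvd_iff)
qed

lemma factor_out_t:
  assumes "H \<noteq> 0"
  obtains e H' where "H = [:[:0, 1:]:] ^ e * H'" "fibre0 H' \<noteq> 0"
proof -
  have "\<not> is_unit [:[:0, 1 :: rat:]:]"
    by (simp add: is_unit_const_poly_iff is_unit_poly_iff)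
  then obtain H' where "H = [:[:0, 1:]:] ^ multiplicity [:[:0, 1:]:] H * H'" "\<not> [:[:0, 1:]:] dvd H'"
    using multiplicity_decompose'[OF assms] by metis
  then show ?thesis using that fibre0_eq_0_iff by metis
qed

section \<open>Elimination and finiteness of intersections\<close>

text \<open>
  A polynomial of least degree in \<open>r\<close> in the ideal \<open>(\<pi>, H)\<close> divides both generators up to factors
  free of \<open>r\<close>; if its degree were positive, primality would force \<open>\<pi>\<close> to divide \<open>H\<close>.
\<close>

lemma eliminate:
  fixes \<pi> H :: "rat poly poly"
  assumes "prime_elem \<pi>" "degree \<pi> > 0" "\<not> \<pi> dvd H"
  obtains R u v where "R \<noteq> 0" "u * \<pi> + v * H = [:R:]"
proof -
  define I where "I = {u * \<pi> + v * H | u v. True}"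
  have I_diff: "a * x - b * y \<in> I" if x: "x \<in> I" and y: "y \<in> I" for a b x y
  proof -
    obtain u v where "x = u * \<pi> + v * H" using x by (auto simp: I_def)
    moreover obtain u' v' where "y = u' * \<pi> + v' * H" using y by (auto simp: I_def)
    ultimately have "a * x - b * y = (a * u - b * u') * \<pi> + (a * v - b * v') * H"
      by (simp add: algebra_simps)
    then show ?thesis by (auto simp: I_def)
  qed
  have "\<pi> = 1 * \<pi> + 0 * H" "H = 0 * \<pi> + 1 * H" by simp_all
  then have gens: "\<pi> \<in> I" "H \<in> I" unfolding I_def by blast+
  have "\<pi> \<noteq> 0" using assms(1) by auto
  define w where "w = arg_min degree (\<lambda>x. x \<in> I \<and> x \<noteq> 0)"
  have w: "w \<in> I" "w \<noteq> 0"
    using arg_min_natI[of "\<lambda>x. x \<in> I \<and> x \<noteq> 0" \<pi> degree] gens \<open>\<pi> \<noteq> 0\<close> by (simp_all add: w_def)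
  have w_min: "degree w \<le> degree x" if "x \<in> I" "x \<noteq> 0" for x
    unfolding w_def by (rule arg_min_nat_le) (use that in auto)
  \<comment> \<open>Pseudo-division, since the coefficients in t form only a ring. The remainder
    lies in \<open>I\<close> and vanishes by minimality of \<open>w\<close>.\<close>
  have div: "\<exists>a q. a \<noteq> 0 \<and> smult a x = w * q" if "x \<in> I" for x
  proof -
    obtain a q where aq: "a \<noteq> 0" "smult a x = w * q + pseudo_mod x w"
      and deg: "pseudo_mod x w = 0 \<or> degree (pseudo_mod x w) < degree w"
      using pseudo_mod[OF w(2), of x] by metis
    have "pseudo_mod x w = [:a:] * x - q * w" using aq(2) by simp
    then have "pseudo_mod x w \<in> I" using I_diff[OF that w(1), of "[:a:]" q] by simp
    then have "pseudo_mod x w = 0" using deg w_min by fastforce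
    then show ?thesis using aq by auto
  qed
  have nonconst: "\<not> \<pi> dvd [:a:]" if "a \<noteq> 0" for a
  proof
    assume "\<pi> dvd [:a:]"
    then have "degree \<pi> \<le> degree [:a:]" using that by (intro dvd_imp_degree_le) auto
    then show False using assms(2) by simp
  qed
  obtain a q where aq: "a \<noteq> 0" "[:a:] * \<pi> = w * q" using div[OF gens(1)] by auto
  obtain b s where bs: "b \<noteq> 0" "[:b:] * H = w * s" using div[OF gens(2)] by auto
  have "\<not> \<pi> dvd w"
  proof
    assume "\<pi> dvd w"
    then have "\<pi> dvd [:b:] * H" using bs(2) by simp
    then show False using prime_elem_dvd_multD[OF assms(1)] nonconst[OF bs(1)] assms(3) by blast
  qed
  \<comment> \<open>As \<open>\<pi>\<close> does not divide \<open>w\<close>, it divides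
    \<open>q\<close> and can be cancelled; then \<open>w\<close> divides a polynomial free of
    r.\<close>
  moreover have "\<pi> dvd w * q" using aq(2) by (metis dvd_triv_right)
  ultimately obtain q' where "q = \<pi> * q'"
    using prime_elem_dvd_multD[OF assms(1)] by (blast elim: dvdE)
  then have "\<pi> * [:a:] = \<pi> * (w * q')" using aq(2) by (simp add: mult_ac)
  then have "[:a:] = w * q'" using \<open>\<pi> \<noteq> 0\<close> by (simp only: mult_cancel_left) simp
  then have "w dvd [:a:]" by (metis dvd_triv_left)
  then have "degree w \<le> degree [:a:]" using aq(1) by (intro dvd_imp_degree_le) auto
  then have "degree w = 0" by simp
  then obtain R where "w = [:R:]" by (rule degree_eq_zeroE)
  then show ?thesis using that w by (auto simp: I_def)
qed

lemma finite_common_zeros: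
  fixes \<pi> H :: "rat poly poly"
  assumes "prime_elem \<pi>" "degree \<pi> > 0" "\<not> \<pi> dvd H"
  shows "finite {t :: 'a::field_char_0. \<exists>r. bpoly \<pi> t r = 0 \<and> bpoly H t r = 0}"
proof -
  obtain R u v where R: "R \<noteq> 0" "u * \<pi> + v * H = [:R:]"
    using eliminate[OF assms] .
  have "rpoly R t = 0" if "bpoly \<pi> t r = 0" "bpoly H t r = 0" for t r :: 'a
  proof -
    have "bpoly [:R:] t r = 0" unfolding R(2)[symmetric] using that by simp
    then show ?thesis by simp
  qed
  then have "{t :: 'a. \<exists>r. bpoly \<pi> t r = 0 \<and> bpoly H t r = 0} \<subseteq> {t. rpoly R t = 0}" by blast
  then show ?thesis using finite_rpoly_roots[OF R(1)] finite_subset by blast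
qed

text \<open>If the fibre over t were a whole line, the minimal polynomial of t would divide every
  coefficient of \<open>\<pi>\<close>, which is impossible for a prime of positive degree in
  r.\<close>

lemma finite_fibre:
  fixes \<pi> :: "rat poly poly" and t :: complex
  assumes "prime_elem \<pi>" "degree \<pi> > 0"
  shows "finite {r. bpoly \<pi> t r = 0}"
proof (cases "map_poly (\<lambda>q. rpoly q t) \<pi> = 0")
  case False
  then show ?thesis unfolding bpoly_def by (rule poly_roots_finite)
next
  case True
  then have root: "rpoly (coeff \<pi> n) t = 0" for n
    by (metis (mono_tags) coeff_0 coeff_map_poly rpoly_0)
  have "lead_coeff \<pi> \<noteq> 0" using assms(1) by auto
  then obtain \<mu> where \<mu>: "irreducible \<mu>" "rpoly \<mu> t = 0"
    using root[of "degree \<pi>"] irreducible_factor_with_root by blast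
  have "[:\<mu>:] dvd \<pi>"
    using irreducible_dvd_if_common_root[OF \<mu> root] by (simp add: const_poly_dvd_iff)
  then obtain \<sigma> where \<sigma>: "\<pi> = [:\<mu>:] * \<sigma>" by (elim dvdE)
  have "\<pi> dvd [:\<mu>:] \<or> \<pi> dvd \<sigma>"
    using prime_elem_dvd_multD[OF assms(1)] \<sigma> by (metis dvd_refl)
  then show ?thesis
  proof
    assume "\<pi> dvd [:\<mu>:]"
    then have "degree \<pi> \<le> degree [:\<mu>:]" using \<mu>(1) by (intro dvd_imp_degree_le) auto
    then show ?thesis using assms(2) by simp
  next
    assume "\<pi> dvd \<sigma>"
    then obtain \<tau> where "\<sigma> = \<pi> * \<tau>" by (elim dvdE)
    then have "\<sigma> * 1 = \<sigma> * ([:\<mu>:] * \<tau>)" using \<sigma> by (simp add: mult_ac)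
    moreover have "\<sigma> \<noteq> 0" using \<sigma> assms(1) by auto
    ultimately have "[:\<mu>:] * \<tau> = 1" by (metis mult_cancel_left)
    then have "is_unit [:\<mu>:]" by (metis dvd_triv_left)
    then have "is_unit \<mu>" by (simp add: is_unit_const_poly_iff)
    then show ?thesis using \<mu>(1) by (simp add: irreducible_def)
  qed
qed

section \<open>Limits as t tends to 0 and the component through the cusp\<close>

lemma tendsto_bpoly:
  "((\<lambda>t. bpoly H t r) \<longlongrightarrow> bpoly H 0 r) (at (0::real))"
proof -
  have "((\<lambda>t. rpoly q t) \<longlongrightarrow> rpoly q 0) (at (0::real))" for q
    unfolding rpoly_def by (intro tendsto_intros)
  then show ?thesis by (induction H) (auto intro!: tendsto_eq_intros)
qed

text \<open>Turns real asymptotics into divisibility. Let d be the exact power of t in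
  \<open>H\<close>. If d < e, the cofactor would vanish on all of t = 0; if d > e, the limit at
  \<open>r0\<close> would be 0. Hence d = e.\<close>

lemma limit_factor_out_t:
  fixes H :: "rat poly poly" and g :: "real \<Rightarrow> real"
  assumes lim: "\<And>r. ((\<lambda>t. bpoly H t r / t ^ e) \<longlongrightarrow> g r) (at 0)" and "g r0 \<noteq> 0"
  obtains H' where "H = [:[:0, 1:]:] ^ e * H'" "\<And>r. bpoly H' 0 r = g r"
proof -
  have "H \<noteq> 0"
  proof
    assume "H = 0"
    then have "((\<lambda>t::real. 0::real) \<longlongrightarrow> g r0) (at 0)" using lim[of r0] by simp
    then have "g r0 = 0" by (simp add: tendsto_const_iff)
    with \<open>g r0 \<noteq> 0\<close> show False by simp
  qed
  then obtain d H' where H': "H = [:[:0, 1:]:] ^ d * H'" "fibre0 H' \<noteq> 0"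
    using factor_out_t by blast
  have H_eq: "bpoly H t r = t ^ d * bpoly H' t r" for t r :: real
    by (simp add: H'(1))
  consider "d < e" | "e < d" | "d = e" by linarith
  then show ?thesis
  proof cases
    case 1
    have "bpoly H' 0 r = 0" for r :: real
    proof -
      have "((\<lambda>t. t ^ (e - d) * (bpoly H t r / t ^ e)) \<longlongrightarrow> 0 ^ (e - d) * g r) (at 0)"
        by (intro tendsto_intros lim)
      moreover have "t ^ (e - d) * (bpoly H t r / t ^ e) = bpoly H' t r" if "t \<noteq> 0" for t
      proof -
        have "t ^ e = t ^ (e - d) * t ^ d" using 1 by (simp flip: power_add)
        then show ?thesis using that by (simp add: H_eq)
      qed
      ultimately have "((\<lambda>t. bpoly H' t r) \<longlongrightarrow> 0 ^ (e - d) * g r) (at 0)"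
        by (auto intro: Lim_transform_eventually simp: eventually_at_filter)
      then have "bpoly H' 0 r = 0 ^ (e - d) * g r"
        using tendsto_bpoly[of H' r] tendsto_unique[OF at_neq_bot] by blast
      then show ?thesis using 1 by simp
    qed
    then have "{x. rpoly (fibre0 H') x = 0} = (UNIV :: real set)" by (simp add: bpoly_at_0)
    then show ?thesis using finite_rpoly_roots[OF H'(2), where 'a = real] by (simp add: infinite_UNIV_char_0)
  next
    case 2
    have "((\<lambda>t. t ^ (d - e) * bpoly H' t r0) \<longlongrightarrow> 0 ^ (d - e) * bpoly H' 0 r0) (at 0)"
      by (intro tendsto_intros tendsto_bpoly)
    moreover have "t ^ (d - e) * bpoly H' t r0 = bpoly H t r0 / t ^ e" if "t \<noteq> 0" for t
    proof -
      have "t ^ d = t ^ (d - e) * t ^ e" using 2 by (simp flip: power_add)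
      then show ?thesis using that by (simp add: H_eq)
    qed
    ultimately have "((\<lambda>t. bpoly H t r0 / t ^ e) \<longlongrightarrow> 0 ^ (d - e) * bpoly H' 0 r0) (at 0)"
      by (auto intro: Lim_transform_eventually simp: eventually_at_filter)
    then have "g r0 = 0 ^ (d - e) * bpoly H' 0 r0"
      using lim[of r0] tendsto_unique[OF at_neq_bot] by blast
    with 2 \<open>g r0 \<noteq> 0\<close> show ?thesis by simp
  next
    case 3
    have "bpoly H' 0 r = g r" for r
    proof -
      have "((\<lambda>t. bpoly H' t r) \<longlongrightarrow> g r) (at 0)"
        by (rule Lim_transform_eventually[OF lim[of r]]) (simp add: eventually_at_filter H_eq 3)
      then show ?thesis
        using tendsto_bpoly[of H' r] tendsto_unique[OF at_neq_bot] by blast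
    qed
    then show ?thesis using that H'(1) 3 by blast
  qed
qed

lemma prime_factor_with_root:
  fixes H :: "rat poly poly"
  assumes "poly (fibre0 H) x = 0" "fibre0 H \<noteq> 0"
  obtains \<pi> where "prime_elem \<pi>" "\<pi> dvd H" "poly (fibre0 \<pi>) x = 0"
proof -
  have "\<exists>\<pi>. prime_elem \<pi> \<and> \<pi> dvd H \<and> poly (fibre0 \<pi>) x = 0"
    using assms
  proof (induction H rule: prime_divisors_induct)
    case (unit H)
    then obtain G where "1 = H * G" by (elim dvdE)
    then have "fibre0 H * fibre0 G = fibre0 1" by (simp flip: fibre0_mult)
    then have "poly (fibre0 H * fibre0 G) x = 1" by (simp only: one_pCons) simp
    with unit show ?case by simp
  next
    case (factor p q)
    then have "prime_elem p" by (blast intro: prime_imp_prime_elem)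
    with factor show ?case
      by (cases "poly (fibre0 p) x = 0") (auto simp: fibre0_mult)
  qed simp
  then show ?thesis using that by blast
qed

text \<open>
  The point \<open>(0, -1)\<close> is a smooth rational point of the component, transversal to \<open>t = 0\<close>.
\<close>

lemma component_through_cusp:
  fixes H :: "rat poly poly" and \<kappa> :: real
  assumes "\<And>r. bpoly H 0 r = \<kappa> * (1 + r)" "\<kappa> \<noteq> 0"
  obtains \<pi> where "prime_elem \<pi>" "degree \<pi> > 0" "\<pi> dvd H" "poly (fibre0 \<pi>) (-1) = 0"
    "poly (pderiv (fibre0 \<pi>)) (-1) \<noteq> 0"
proof -
  \<comment> \<open>The limit \<open>\<kappa>\<close> is a priori only real; as the value of
    \<open>fibre0 H\<close> at 0 it is rational.\<close>
  define k where "k = poly (fibre0 H) 0"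
  have k: "of_rat k = \<kappa>"
    using assms(1)[of 0] rpoly_of_rat[of "fibre0 H" 0, where 'a = real] by (simp add: k_def bpoly_at_0)
  then have "k \<noteq> 0" using assms(2) by auto
  have "fibre0 H - [:k, k:] = 0"
  proof (rule ccontr)
    assume "fibre0 H - [:k, k:] \<noteq> 0"
    then have "finite {x :: real. rpoly (fibre0 H - [:k, k:]) x = 0}" by (rule finite_rpoly_roots)
    moreover have "rpoly (fibre0 H - [:k, k:]) x = 0" for x :: real
      using assms(1)[of x] k by (simp add: bpoly_at_0 algebra_simps)
    ultimately show False by (simp add: infinite_UNIV_char_0)
  qed
  then have fH: "fibre0 H = [:k, k:]" by simp
  then obtain \<pi> where \<pi>: "prime_elem \<pi>" "\<pi> dvd H" "poly (fibre0 \<pi>) (-1) = 0"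
    using prime_factor_with_root[of H "-1"] \<open>k \<noteq> 0\<close> by auto
  obtain \<sigma> where "H = \<pi> * \<sigma>" using \<pi>(2) by (elim dvdE)
  then have prod: "fibre0 \<pi> * fibre0 \<sigma> = [:k, k:]" using fH by (simp add: fibre0_mult)
  \<comment> \<open>A simple root of the product is a simple root of the factor that vanishes
    there.\<close>
  have "poly (pderiv (fibre0 \<pi> * fibre0 \<sigma>)) (-1) = k" unfolding prod by (simp add: pderiv_pCons)
  then have simple: "poly (pderiv (fibre0 \<pi>)) (-1) \<noteq> 0"
    using \<pi>(3) \<open>k \<noteq> 0\<close> by (auto simp: pderiv_mult)
  have "degree \<pi> > 0"
  proof (rule ccontr)
    assume "\<not> degree \<pi> > 0"
    then obtain q where "\<pi> = [:q:]" using degree_eq_zeroE by blast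
    then show False using simple by (simp add: pderiv_pCons)
  qed
  then show ?thesis using that \<pi> simple by blast
qed

lemma not_dvd_if_nonzero_at_cusp:
  assumes "poly (fibre0 \<pi>) x = 0" "poly (fibre0 H) x \<noteq> 0"
  shows "\<not> \<pi> dvd H"
  using assms by (auto elim!: dvdE simp: fibre0_mult)

text \<open>If t were a product with factor \<open>\<pi>\<close>, restriction to t = 0 would force t
  to divide the other factor, leaving \<open>\<pi>\<close> a unit.\<close>

lemma not_dvd_t:
  assumes "prime_elem \<pi>" "fibre0 \<pi> \<noteq> 0"
  shows "\<not> \<pi> dvd [:[:0, 1:]:]"
proof
  assume "\<pi> dvd [:[:0, 1:]:]"
  then obtain \<sigma> where \<sigma>: "[:[:0, 1:]:] = \<pi> * \<sigma>" by (elim dvdE)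
  then have "fibre0 \<pi> * fibre0 \<sigma> = fibre0 [:[:0, 1:]:]" by (simp only: fibre0_mult)
  then have "fibre0 \<pi> * fibre0 \<sigma> = 0" by simp
  then have "[:[:0, 1:]:] dvd \<sigma>" using assms(2) by (simp add: fibre0_eq_0_iff)
  then obtain \<tau> where "\<sigma> = [:[:0, 1:]:] * \<tau>" by (elim dvdE)
  then have "[:[:0, 1:]:] * 1 = [:[:0, 1:]:] * (\<pi> * \<tau>)" using \<sigma> by (simp add: mult_ac)
  then have "\<pi> * \<tau> = 1" by (metis mult_cancel_left pCons_eq_0_iff one_neq_zero)
  then have "is_unit \<pi>" by (metis dvd_triv_left)
  with assms(1) show False by simp
qed

text \<open>For conditions that vanish on the whole line t = 0, where the test at the cusp says
  nothing until the power of t is removed.\<close>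

lemma not_dvd_by_order:
  assumes "prime_elem \<pi>" "fibre0 \<pi> \<noteq> 0" "poly (fibre0 \<pi>) x = 0"
    "H = [:[:0, 1:]:] ^ e * H'" "poly (fibre0 H') x \<noteq> 0"
  shows "\<not> \<pi> dvd H"
proof
  assume "\<pi> dvd H"
  then have "\<pi> dvd [:[:0, 1:]:] ^ e \<or> \<pi> dvd H'"
    using assms(1,4) by (metis prime_elem_dvd_multD)
  then show False
    using not_dvd_if_nonzero_at_cusp[OF assms(3,5)] not_dvd_t[OF assms(1,2)]
      prime_elem_dvd_power[OF assms(1)] by blast
qed

subsection \<open>Specialisation to points of small degree\<close>

text \<open>No cancellation can occur: the term of highest degree in r dominates. Only the degree of
  \<open>q\<close> enters, not its lower coefficients.\<close>

lemma degree_poly_substitute: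
  fixes H :: "rat poly poly"
  assumes "H \<noteq> 0" "\<And>i. degree (coeff H i) < degree q"
  shows "poly H q \<noteq> 0 \<and> degree (poly H q) = degree q * degree H + degree (lead_coeff H)"
  using assms
proof (induction H)
  case (pCons a H)
  show ?case
  proof (cases "H = 0")
    case True
    then show ?thesis using pCons by simp
  next
    case False
    have "degree (coeff H i) < degree q" for i using pCons.prems(2)[of "Suc i"] by simp
    with pCons.IH False have IH: "poly H q \<noteq> 0"
      "degree (poly H q) = degree q * degree H + degree (lead_coeff H)" by auto
    have a: "degree a < degree q" using pCons.prems(2)[of 0] by simp
    then have "degree (q * poly H q) = degree q + degree (poly H q)"
      using IH(1) by (intro degree_mult_eq) auto
    moreover from this a have "degree (a + q * poly H q) = degree (q * poly H q)"
      by (intro degree_add_eq_right) simp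
    ultimately have "degree (poly (pCons a H) q) = degree q + degree (poly H q)" by simp
    then show ?thesis using IH(2) a False by (auto simp: degree_pCons_eq)
  qed
qed simp

lemma coeff_0_poly_substitute: "coeff (poly H q) 0 = poly (fibre0 H) (coeff q 0)"
  by (induction H) (simp_all add: coeff_mult_0 poly_0_coeff_0)

text \<open>The chain rule at t = 0: the partial derivative in t plus q'(0) times the partial
  derivative in r.\<close>

lemma coeff_1_poly_substitute:
  "coeff (poly H q) 1 = poly (map_poly (\<lambda>p. coeff p 1) H) (coeff q 0)
     + coeff q 1 * poly (pderiv (fibre0 H)) (coeff q 0)"
proof (induction H)
  case (pCons a H)
  have "coeff (q * poly H q) 1 = coeff q 0 * coeff (poly H q) 1 + coeff q 1 * coeff (poly H q) 0"
    by (simp add: coeff_mult)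
  with pCons show ?case
    by (simp add: map_poly_pCons pderiv_pCons coeff_0_poly_substitute algebra_simps)
qed simp

lemma infinite_rat_avoid:
  fixes A :: "rat set"
  assumes "finite A"
  obtains s where "s \<notin> A"
  using assms infinite_UNIV_char_0 ex_new_if_finite by blast

lemma generic_point_of_degree_prime_to:
  fixes \<pi> :: "rat poly poly" and p :: nat
  assumes \<pi>: "prime_elem \<pi>" "degree \<pi> > 0" "poly (fibre0 \<pi>) (-1) = 0"
      "poly (pderiv (fibre0 \<pi>)) (-1) \<noteq> 0"
    and p: "prime p" and \<H>: "finite \<H>" "\<And>H. H \<in> \<H> \<Longrightarrow> \<not> \<pi> dvd H"
  obtains g z r where "irreducible g" "\<not> p dvd degree g" "rpoly g z = 0" "z \<noteq> (0 :: complex)"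
    "r \<in> adjoin z" "bpoly \<pi> z r = 0" "\<And>H. H \<in> \<H> \<Longrightarrow> bpoly H z r \<noteq> 0"
proof -
  have "\<pi> \<noteq> 0" using \<pi>(1) by auto
  have fib: "fibre0 \<pi> \<noteq> 0" using \<pi>(4) by auto
  \<comment> \<open>Larger than every degree in t, and at least 2 so that t^M leaves the linear
    coefficient of \<open>\<rho> s\<close> alone.\<close>
  define M where "M = Suc (Suc (\<Sum>i\<le>degree \<pi>. degree (coeff \<pi> i)))"
  have M: "degree (coeff \<pi> i) < M" for i
  proof (cases "i \<le> degree \<pi>")
    case True
    then have "degree (coeff \<pi> i) \<le> (\<Sum>i\<le>degree \<pi>. degree (coeff \<pi> i))"
      by (intro member_le_sum) auto
    then show ?thesis by (simp add: M_def)
  qed (simp add: M_def coeff_eq_0)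
  define D where "D = M * degree \<pi> + degree (lead_coeff \<pi>)"
  have "D \<ge> 2" using \<pi>(2) by (cases "degree \<pi>") (simp_all add: D_def M_def)
  define i :: nat where "i = (if p dvd D then 1 else 0)"
  have "\<not> p dvd 1" using p by auto
  have i: "i = 0 \<or> i = 1" "\<not> p dvd (D - i)"
    using \<open>\<not> p dvd 1\<close> \<open>D \<ge> 2\<close> dvd_diff_nat[of p D "D - 1"] by (auto simp: i_def)
  define \<rho> :: "rat \<Rightarrow> rat poly" where "\<rho> s = [:-1:] + monom s i + monom 1 M" for s
  have deg_\<rho>: "degree (\<rho> s) = M" for s
  proof -
    have "degree ([:-1:] + monom s i) \<le> 1"
      using i(1) by (intro degree_add_le) (auto intro: order_trans[OF degree_monom_le])
    then have "degree ([:-1:] + monom s i) < degree (monom (1::rat) M)"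
      by (simp add: degree_monom_eq M_def)
    then show ?thesis unfolding \<rho>_def by (simp add: degree_add_eq_right degree_monom_eq)
  qed
  have \<rho>_coeff: "coeff (\<rho> s) 0 = (if i = 0 then s - 1 else -1)" "i = 1 \<Longrightarrow> coeff (\<rho> s) 1 = s" for s
    by (auto simp: \<rho>_def M_def)
  define h where "h s = poly \<pi> (\<rho> s)" for s
  have deg_h: "h s \<noteq> 0" "degree (h s) = D" for s
    using degree_poly_substitute[OF \<open>\<pi> \<noteq> 0\<close>, of "\<rho> s"] M by (simp_all add: h_def deg_\<rho> D_def)
  define c where "c = poly (map_poly (\<lambda>p. coeff p 1) \<pi>) (-1)"
  define d where "d = poly (pderiv (fibre0 \<pi>)) (-1)"
  \<comment> \<open>Excluded slopes at t = 0: for i = 0 those whose curve meets C there, for i = 1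
    the single one tangent to C at the cusp.\<close>
  define S1 where "S1 = (if i = 0 then {s. poly (fibre0 \<pi>) (s - 1) = 0} else {- c / d})"
  have "finite S1"
  proof -
    have "{s. poly (fibre0 \<pi>) (s - 1) = 0} \<subseteq> (\<lambda>x. x + 1) ` {x. poly (fibre0 \<pi>) x = 0}"
      by (auto intro!: image_eqI[of _ _ "_ - 1"])
    then have "finite {s. poly (fibre0 \<pi>) (s - 1) = 0}"
      using poly_roots_finite[OF fib] by (meson finite_imageI finite_subset)
    then show ?thesis by (simp add: S1_def)
  qed
  \<comment> \<open>The value t = 0 is left out because changing s need not move the curve there;
    \<open>S1\<close> keeps z away from it.\<close>
  define B where "B = (\<Union>H\<in>\<H>. {t :: complex. \<exists>r. bpoly \<pi> t r = 0 \<and> bpoly H t r = 0}) - {0}"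
  have "finite B"
    unfolding B_def using \<H> finite_common_zeros[OF \<pi>(1,2)] by blast
  define S2 where "S2 = (\<Union>t\<in>B. {s. bpoly \<pi> t (rpoly (\<rho> s) t) = 0})"
  have "finite S2"
    unfolding S2_def
  proof (rule finite_UN_I[OF \<open>finite B\<close>])
    fix t assume "t \<in> B"
    then have "t \<noteq> 0" by (simp add: B_def)
    \<comment> \<open>For fixed nonzero t, distinct s give distinct r, and the fibre of C over t is
      finite; so only finitely many s are bad.\<close>
    have "inj_on (\<lambda>s. rpoly (\<rho> s) t) UNIV"
      using \<open>t \<noteq> 0\<close> by (auto simp: inj_on_def \<rho>_def)
    moreover have "(\<lambda>s. rpoly (\<rho> s) t) ` {s. bpoly \<pi> t (rpoly (\<rho> s) t) = 0} \<subseteq> {r. bpoly \<pi> t r = 0}"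
      by auto
    ultimately show "finite {s. bpoly \<pi> t (rpoly (\<rho> s) t) = 0}"
      using finite_fibre[OF \<pi>(1,2)] by (meson finite_imageD finite_subset inj_on_subset subset_UNIV)
  qed
  obtain s where s: "s \<notin> S1" "s \<notin> S2"
    using infinite_rat_avoid[of "S1 \<union> S2"] \<open>finite S1\<close> \<open>finite S2\<close> by blast
  \<comment> \<open>Removes exactly the intersection at the cusp: none for i = 0, one of
    multiplicity one for i = 1.\<close>
  have "\<exists>q. h s = monom 1 i * q \<and> coeff q 0 \<noteq> 0"
  proof (cases "i = 0")
    case True
    then have "coeff (h s) 0 \<noteq> 0"
      using s(1) by (simp add: h_def coeff_0_poly_substitute \<rho>_coeff S1_def)
    then show ?thesis using True by (intro exI[of _ "h s"]) simp
  next
    case False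
    then have "i = 1" using i by simp
    have h0: "coeff (h s) 0 = 0"
      using \<open>i = 1\<close> \<pi>(3) by (simp add: h_def coeff_0_poly_substitute \<rho>_coeff)
    have "coeff (h s) 1 = c + s * d"
      unfolding h_def coeff_1_poly_substitute using \<open>i = 1\<close> \<rho>_coeff by (simp add: c_def d_def)
    moreover have "c + s * d \<noteq> 0"
      using s(1) \<open>i = 1\<close> \<pi>(4) by (auto simp: S1_def d_def field_simps add_eq_0_iff)
    moreover obtain a q where "h s = pCons a q" by (cases "h s")
    ultimately show ?thesis
      using h0 \<open>i = 1\<close> by (intro exI[of _ q]) (simp add: monom_altdef)
  qed
  then obtain q where q: "h s = monom 1 i * q" "coeff q 0 \<noteq> 0" by blast
  then have "q \<noteq> 0" by auto
  then have "degree (h s) = i + degree q"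
    unfolding q(1) by (subst degree_mult_eq) (simp_all add: degree_monom_eq)
  then have "degree q = D - i" using deg_h by simp
  then obtain g where g: "irreducible g" "g dvd q" "\<not> p dvd degree g"
    using irreducible_factor_degree[of p q] i(2) \<open>q \<noteq> 0\<close> by metis
  have "degree g \<noteq> 0" using g(3) by (metis dvd_0_right)
  then have "\<not> constant (poly (map_poly of_rat g :: complex poly))"
    by (simp add: constant_degree)
  then obtain z :: complex where z: "rpoly g z = 0"
    unfolding rpoly_def using fundamental_theorem_of_algebra by blast
  have qz: "rpoly q z = 0" using g(2) z by (auto elim!: dvdE)
  have "z \<noteq> 0"
  proof
    assume "z = 0"
    then have "of_rat (coeff q 0) = (0 :: complex)"
      using qz rpoly_of_rat[of q 0, where 'a = complex] by (simp add: poly_0_coeff_0)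
    with q(2) show False by simp
  qed
  define r where "r = rpoly (\<rho> s) z"
  have zero: "bpoly \<pi> z r = 0"
    using qz q(1) by (simp add: r_def h_def flip: rpoly_poly)
  moreover have "bpoly H z r \<noteq> 0" if "H \<in> \<H>" for H
  proof
    assume "bpoly H z r = 0"
    then have "z \<in> B" using that zero \<open>z \<noteq> 0\<close> by (auto simp: B_def)
    then have "s \<in> S2" using zero by (auto simp: S2_def r_def)
    with s(2) show False by simp
  qed
  ultimately show ?thesis
    using that[OF g(1,3) z \<open>z \<noteq> 0\<close>, of r] by (simp add: r_def adjoinI)
qed

subsection \<open>Order conditions as polynomials\<close>

text \<open>
  Numerators and denominators of abscissa and slope, cleared of fractions; \<open>c\<close> and \<open>t\<close> stand for
  \<open>a\<^sub>1\<close> and \<open>a\<^sub>3\<close>, and \<open>a\<^sub>2 = t (1 - t)\<close>.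
\<close>

primrec cleared :: "'a::comm_ring_1 \<Rightarrow> 'a \<Rightarrow> nat \<Rightarrow> 'a \<times> 'a \<times> 'a \<times> 'a" where
  "cleared c t 0 = (- (t * (1 - t)), 1, 1 - (1 - t) * c, 1 - t)"
| "cleared c t (Suc m) = (case cleared c t m of (x, x', l, l') \<Rightarrow>
     (- t * l * x', l' * x, - l * (- t * l * x') - c * l' * (- t * l * x') - t * l' * (l' * x),
      l' * (- t * l * x')))"

definition slope_num :: "'a::comm_ring_1 \<Rightarrow> 'a \<Rightarrow> nat \<Rightarrow> 'a" where
  "slope_num c t m = fst (snd (snd (cleared c t m)))"

text \<open>The recursion uses ring operations only, so it commutes with evaluation and serves both
  as a polynomial and as its value.\<close>

lemma bpoly_cleared:
  "cleared (bpoly C t r) (bpoly T t r) m =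
     map_prod (\<lambda>H. bpoly H t r) (map_prod (\<lambda>H. bpoly H t r) (map_prod (\<lambda>H. bpoly H t r) (\<lambda>H. bpoly H t r)))
       (cleared C T m)"
proof (induction m)
  case (Suc m)
  obtain x x' l l' where "cleared C T m = (x, x', l, l')" by (metis prod_cases4)
  with Suc show ?case by simp
qed simp

lemma bpoly_slope_num: "bpoly (slope_num C T m) t r = slope_num (bpoly C t r) (bpoly T t r) m"
  by (cases "cleared C T m") (simp add: slope_num_def bpoly_cleared)

lemma cleared_multiple:
  fixes c t :: "'a::field"
  assumes "t \<noteq> 0" "1 - t \<noteq> 0" "\<forall>i<m. slope_num c t i \<noteq> 0" "cleared c t m = (x, x', l, l')"
  shows "x \<noteq> 0 \<and> x' \<noteq> 0 \<and> l' \<noteq> 0 \<and> abscissa c (t * (1 - t)) t m = x / x' \<and> slope c (t * (1 - t)) t m = l / l'"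
  using assms(3,4)
proof (induction m arbitrary: x x' l l')
  case 0
  then have eqs: "x = - (t * (1 - t))" "x' = 1" "l = 1 - (1 - t) * c" "l' = 1 - t" by auto
  have "slope c (t * (1 - t)) t 0 = 1 / (1 - t) - c" using assms(1) by simp
  also have "\<dots> = l / l'" using assms(2) unfolding eqs by (simp add: diff_divide_distrib)
  finally show ?case using assms(1,2) eqs by simp
next
  case (Suc m)
  obtain y y' k k' where eq: "cleared c t m = (y, y', k, k')" by (metis prod_cases4)
  then have IH: "y \<noteq> 0" "y' \<noteq> 0" "k' \<noteq> 0"
    "abscissa c (t * (1 - t)) t m = y / y'" "slope c (t * (1 - t)) t m = k / k'"
    using Suc.IH[OF _ eq] Suc.prems(1) by auto
  have "k \<noteq> 0" using Suc.prems(1) eq by (auto simp: slope_num_def dest: spec[of _ m])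
  have new: "x = - t * k * y'" "x' = k' * y" "l = - k * x - c * k' * x - t * k' * x'" "l' = k' * x"
    using Suc.prems(2) eq by auto
  have nz: "x \<noteq> 0" "x' \<noteq> 0" "l' \<noteq> 0"
    using new IH \<open>k \<noteq> 0\<close> assms(1) by simp_all
  have ab: "abscissa c (t * (1 - t)) t (Suc m) = x / x'"
    using IH new by (simp add: Let_def)
  have "slope c (t * (1 - t)) t (Suc m) =
      - slope c (t * (1 - t)) t m - c - t / abscissa c (t * (1 - t)) t (Suc m)"
    by (simp add: Let_def)
  then have "slope c (t * (1 - t)) t (Suc m) = - (k / k') - c - t / (x / x')"
    by (simp only: IH(5) ab)
  also have "\<dots> = l / l'"
    using nz IH(3) unfolding new(3,4) by (simp add: field_simps)
  finally show ?case using nz ab by blast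
qed

text \<open>Both e and \<open>\<kappa>\<close> are independent of r: once t^e is divided out, the
  restriction to t = 0 is a nonzero constant. The property is stable under products.\<close>

definition monomial_asymp :: "(real \<Rightarrow> real \<Rightarrow> real) \<Rightarrow> bool" where
  "monomial_asymp f \<longleftrightarrow> (\<exists>e \<kappa>. \<kappa> \<noteq> 0 \<and> (\<forall>r. ((\<lambda>t. f r t / t ^ e) \<longlongrightarrow> \<kappa>) (at 0)))"

lemma monomial_asymp_mult:
  assumes "monomial_asymp f" "monomial_asymp g"
  shows "monomial_asymp (\<lambda>r t. f r t * g r t)"
proof -
  obtain e \<kappa> where 1: "\<kappa> \<noteq> 0" "\<And>r. ((\<lambda>t. f r t / t ^ e) \<longlongrightarrow> \<kappa>) (at 0)"
    using assms(1) by (auto simp: monomial_asymp_def)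
  obtain e' \<kappa>' where 2: "\<kappa>' \<noteq> 0" "\<And>r. ((\<lambda>t. g r t / t ^ e') \<longlongrightarrow> \<kappa>') (at 0)"
    using assms(2) by (auto simp: monomial_asymp_def)
  have "((\<lambda>t. f r t * g r t / t ^ (e + e')) \<longlongrightarrow> \<kappa> * \<kappa>') (at 0)" for r
    using tendsto_mult[OF 1(2) 2(2), of r r] by (simp add: power_add)
  then show ?thesis
    unfolding monomial_asymp_def using 1(1) 2(1) by (intro exI[of _ "e + e'"] exI[of _ "\<kappa> * \<kappa>'"]) simp
qed

lemma monomial_asymp_nonzero:
  assumes "monomial_asymp f"
  shows "eventually (\<lambda>t. f r t \<noteq> 0) (at 0)"
proof -
  obtain e \<kappa> where "\<kappa> \<noteq> 0" "((\<lambda>t. f r t / t ^ e) \<longlongrightarrow> \<kappa>) (at 0)"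
    using assms unfolding monomial_asymp_def by blast
  then have "eventually (\<lambda>t. f r t / t ^ e \<noteq> 0) (at 0)"
    using tendsto_imp_eventually_ne by blast
  then show ?thesis by (rule eventually_mono) auto
qed

lemma tendsto_perturbed_slope:
  assumes "m \<le> K"
  shows "((\<lambda>t. perturbed_slope K r m t / t) \<longlongrightarrow> - (1 + (if m = K then r else 0))) (at 0)"
proof -
  define B where "B t = (perturbed_slope K r m t / nodal_slope m t - 1) / t ^ (K - m)" for t
  have B: "(B \<longlongrightarrow> r) (at 0)" using perturbation[OF assms] by (simp add: B_def[abs_def])
  \<comment> \<open>The limit \<open>0 ^ (K - m)\<close> is 1 for m = K and 0 before, so r enters
    only at the last index.\<close>
  have "((\<lambda>t. (1 + B t * t ^ (K - m)) * (nodal_slope m t / t)) \<longlongrightarrow> (1 + r * 0 ^ (K - m)) * - 1) (at 0)"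
    by (intro tendsto_intros B tendsto_nodal_slope)
  then have lim: "((\<lambda>t. perturbed_slope K r m t / t) \<longlongrightarrow> (1 + r * 0 ^ (K - m)) * - 1) (at 0)"
  proof (rule Lim_transform_eventually)
    show "eventually (\<lambda>t. (1 + B t * t ^ (K - m)) * (nodal_slope m t / t) = perturbed_slope K r m t / t) (at 0)"
    proof -
      have "eventually (\<lambda>t. nodal_slope m t / t \<noteq> 0) (at 0)"
        by (rule tendsto_imp_eventually_ne[OF tendsto_nodal_slope]) simp
      then show ?thesis
        using eventually_nonzero_at_0 by eventually_elim (simp add: B_def)
    qed
  qed
  also have "(1 + r * 0 ^ (K - m)) * - 1 = - (1 + (if m = K then r else 0))"
    using assms by auto
  finally show ?thesis .
qed

context
  fixes K :: nat
begin

private definition cl :: "nat \<Rightarrow> real \<Rightarrow> real \<Rightarrow> real \<times> real \<times> real \<times> real" where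
  "cl m r t = cleared (1 + 2 * t + r * t ^ (K + 1)) t m"

private definition sn :: "nat \<Rightarrow> real \<Rightarrow> real \<Rightarrow> real" where
  "sn m r t = slope_num (1 + 2 * t + r * t ^ (K + 1)) t m"

text \<open>The numerator is the slope times its denominator. As the slope behaves like - t, up to
  the factor 1 + r at index K, the exponent rises by one and the constant changes sign.\<close>

private lemma slope_num_limit:
  assumes "m \<le> K" "\<forall>i<m. monomial_asymp (sn i)" "monomial_asymp (\<lambda>r t. snd (snd (snd (cl m r t))))"
  shows "\<exists>e \<kappa>. \<kappa> \<noteq> 0 \<and> (\<forall>r. ((\<lambda>t. sn m r t / t ^ e) \<longlongrightarrow> \<kappa> * (1 + (if m = K then r else 0))) (at 0))"
proof -
  obtain e \<kappa> where e: "\<kappa> \<noteq> 0" "\<And>r. ((\<lambda>t. snd (snd (snd (cl m r t))) / t ^ e) \<longlongrightarrow> \<kappa>) (at 0)"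
    using assms(3) by (auto simp: monomial_asymp_def)
  have "((\<lambda>t. sn m r t / t ^ Suc e) \<longlongrightarrow> - \<kappa> * (1 + (if m = K then r else 0))) (at 0)" for r
  proof -
    have "((\<lambda>t. perturbed_slope K r m t / t * (snd (snd (snd (cl m r t))) / t ^ e)) \<longlongrightarrow>
        - (1 + (if m = K then r else 0)) * \<kappa>) (at 0)"
      by (intro tendsto_mult tendsto_perturbed_slope e assms(1))
    moreover have "eventually (\<lambda>t. perturbed_slope K r m t / t * (snd (snd (snd (cl m r t))) / t ^ e) =
        sn m r t / t ^ Suc e) (at 0)"
    proof -
      have "eventually (\<lambda>t. \<forall>i\<in>{..<m}. sn i r t \<noteq> 0) (at 0)"
        using assms(2) by (intro eventually_ball_finite) (auto intro: monomial_asymp_nonzero)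
      moreover have "eventually (\<lambda>t::real. 1 - t \<noteq> 0) (at 0)"
        by (rule tendsto_imp_eventually_ne[where c = 1]) (auto intro!: tendsto_eq_intros)
      ultimately show ?thesis
        using eventually_nonzero_at_0
      proof eventually_elim
        case (elim t)
        obtain x x' l l' where eq: "cl m r t = (x, x', l, l')" by (metis prod_cases4)
        have "l' \<noteq> 0 \<and> perturbed_slope K r m t = l / l'"
          using cleared_multiple[of t m "1 + 2 * t + r * t ^ (K + 1)" x x' l l'] elim eq
          by (auto simp: cl_def sn_def perturbed_slope_def)
        moreover have "sn m r t = l" using eq by (simp add: sn_def cl_def slope_num_def)
        moreover have "t ^ Suc e = t * t ^ e" by simp
        ultimately show ?case using eq by (simp only: snd_conv) simp
      qed
    qed
    ultimately have "((\<lambda>t. sn m r t / t ^ Suc e) \<longlongrightarrow> - (1 + (if m = K then r else 0)) * \<kappa>) (at 0)"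
      by (rule Lim_transform_eventually)
    also have "- (1 + (if m = K then r else 0)) * \<kappa> = - \<kappa> * (1 + (if m = K then r else 0))"
      by (simp add: algebra_simps)
    finally show ?thesis .
  qed
  moreover have "- \<kappa> \<noteq> 0" using e(1) by simp
  ultimately show ?thesis by blast
qed

text \<open>Every component except the slope numerator is a product of earlier quantities. That
  numerator is a sum with cancellation, so its order comes from the limit of the slope
  instead.\<close>

private lemma cleared_asymp:
  assumes "m \<le> K"
  shows "(\<forall>i<m. monomial_asymp (sn i)) \<and> monomial_asymp (\<lambda>r t. fst (cl m r t)) \<and>
    monomial_asymp (\<lambda>r t. fst (snd (cl m r t))) \<and> monomial_asymp (\<lambda>r t. snd (snd (snd (cl m r t))))"
  using assms
proof (induction m)
  case 0
  have 2: "((\<lambda>t::real. (1 - t) / t ^ 0) \<longlongrightarrow> 1) (at 0)"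
    by (auto intro!: tendsto_eq_intros)
  have 1: "((\<lambda>t::real. - (t * (1 - t)) / t ^ 1) \<longlongrightarrow> - 1) (at 0)"
    by (rule tendsto_at_0_transform[where f = "\<lambda>t. - (1 - t)"]) (auto intro!: tendsto_eq_intros)
  have "monomial_asymp (\<lambda>r t. - (t * (1 - t)))"
    unfolding monomial_asymp_def using 1 by (intro exI[of _ 1] exI[of _ "-1"]) simp
  moreover have "monomial_asymp (\<lambda>r t. 1 - t)" "monomial_asymp (\<lambda>r t. 1)"
    unfolding monomial_asymp_def using 2 by (intro exI[of _ 0] exI[of _ 1]; simp)+
  ultimately show ?case by (simp add: cl_def)
next
  case (Suc m)
  then have IH: "\<forall>i<m. monomial_asymp (sn i)" "monomial_asymp (\<lambda>r t. fst (cl m r t))"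
    "monomial_asymp (\<lambda>r t. fst (snd (cl m r t)))" "monomial_asymp (\<lambda>r t. snd (snd (snd (cl m r t))))"
    by simp_all
  have sn: "monomial_asymp (sn m)"
    using slope_num_limit[OF _ IH(1,4)] Suc.prems by (simp add: monomial_asymp_def)
  have "((\<lambda>t::real. - t / t ^ 1) \<longlongrightarrow> - 1) (at 0)"
    by (rule Lim_transform_eventually[OF tendsto_const]) (simp add: eventually_at_filter)
  then have t: "monomial_asymp (\<lambda>r t. - t)"
    unfolding monomial_asymp_def by (intro exI[of _ 1] exI[of _ "-1"]) simp
  have step: "cl (Suc m) r t = (- t * sn m r t * fst (snd (cl m r t)), snd (snd (snd (cl m r t))) * fst (cl m r t),
      sn (Suc m) r t, snd (snd (snd (cl m r t))) * (- t * sn m r t * fst (snd (cl m r t))))" for r t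
    by (simp add: cl_def sn_def slope_num_def split: prod.splits)
  have x: "monomial_asymp (\<lambda>r t. - t * sn m r t * fst (snd (cl m r t)))"
    by (intro monomial_asymp_mult[of "\<lambda>r t. - t * sn m r t"] monomial_asymp_mult[of "\<lambda>r t. - t"] t sn IH)
  have x': "monomial_asymp (\<lambda>r t. snd (snd (snd (cl m r t))) * fst (cl m r t))"
    by (rule monomial_asymp_mult) (fact IH)+
  have l': "monomial_asymp (\<lambda>r t. snd (snd (snd (cl m r t))) * (- t * sn m r t * fst (snd (cl m r t))))"
    by (rule monomial_asymp_mult[OF IH(4) x])
  show ?case
    unfolding step fst_conv snd_conv using IH(1) sn x x' l' by (simp only: less_Suc_eq) blast
qed

lemma slope_num_asymp:
  assumes "m < K"
  shows "\<exists>e \<kappa>. \<kappa> \<noteq> 0 \<and>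
    (\<forall>r. ((\<lambda>t. slope_num (1 + 2 * t + r * t ^ (K + 1)) t m / t ^ e) \<longlongrightarrow> \<kappa>) (at (0::real)))"
proof -
  have "m \<le> K" using assms by simp
  note c = cleared_asymp[OF this]
  show ?thesis
    using slope_num_limit[OF \<open>m \<le> K\<close> conjunct1[OF c] conjunct2[OF conjunct2[OF conjunct2[OF c]]]] assms
    by (simp add: sn_def)
qed

lemma slope_num_asymp_last:
  "\<exists>e \<kappa>. \<kappa> \<noteq> 0 \<and>
    (\<forall>r. ((\<lambda>t. slope_num (1 + 2 * t + r * t ^ (K + 1)) t K / t ^ e) \<longlongrightarrow> \<kappa> * (1 + r)) (at (0::real)))"
proof -
  note c = cleared_asymp[OF order_refl]
  show ?thesis
    using slope_num_limit[OF order_refl conjunct1[OF c] conjunct2[OF conjunct2[OF conjunct2[OF c]]]]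
    by (simp add: sn_def)
qed

end

subsection \<open>Discriminant and \<open>j\<close>-invariant of the family\<close>

definition family_curve :: "'a::field \<Rightarrow> 'a \<Rightarrow> 'a weierstrass" where
  "family_curve c t = Weierstrass c (t * (1 - t)) t 0 0"

definition family_disc :: "'a::comm_ring_1 \<Rightarrow> 'a \<Rightarrow> 'a" where
  "family_disc c t = t ^ 3 *
     (- (1 - t) * (c ^ 2 + 4 * t * (1 - t)) ^ 2 + c ^ 3 - 27 * t + 36 * c * t * (1 - t))"

definition family_c4 :: "'a::comm_ring_1 \<Rightarrow> 'a \<Rightarrow> 'a" where
  "family_c4 c t = (c ^ 2 + 4 * t * (1 - t)) ^ 2 - 24 * c * t"

lemma discriminant_family: "discriminant (family_curve c t) = family_disc c t"
  by (simp add: family_curve_def family_disc_def discriminant_def wb2_def wb4_def wb6_def wb8_def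
      algebra_simps eval_nat_numeral)

lemma wc4_family: "wc4 (family_curve c t) = family_c4 c t"
  by (simp add: family_curve_def family_c4_def wc4_def wb2_def wb4_def algebra_simps)

text \<open>Here \<open>d\<close> measures the distance of a1 from its nodal value, and the
  discriminant vanishes with it. The last factor is -1 at t = d = 0.\<close>

lemma family_disc_nodal:
  fixes t d :: "'a::comm_ring_1"
  shows "family_disc (1 + 2 * t + d) t = t ^ 3 * d *
    (- (1 - t) * (2 * (1 + 8 * t) * (2 * (1 + 2 * t) + d) + d * (2 * (1 + 2 * t) + d) ^ 2)
      + 3 * (1 + 2 * t) ^ 2 + 3 * (1 + 2 * t) * d + d ^ 2 + 36 * t * (1 - t))"
  by (simp add: family_disc_def algebra_simps power2_eq_square power3_eq_cube)

lemma bpoly_smult [simp]: "bpoly (smult p H) t r = rpoly p t * bpoly H t r"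
  using bpoly_mult[of "[:p:]" H t r] by simp

lemma bpoly_family_disc: "bpoly (family_disc C T) t r = family_disc (bpoly C t r) (bpoly T t r)"
  by (simp add: family_disc_def)

lemma bpoly_family_c4: "bpoly (family_c4 C T) t r = family_c4 (bpoly C t r) (bpoly T t r)"
  by (simp add: family_c4_def)

lemma poly_fibre0: "poly (fibre0 H) x = bpoly H 0 x"
  using rpoly_of_rat[of "fibre0 H" x, where 'a = rat] by (simp add: bpoly_at_0)

text \<open>The numerator of \<open>m (c\<^sub>4\<^sup>3 / \<Delta>)\<close>; it vanishes where the \<open>j\<close>-invariant is a root of \<open>m\<close>.\<close>

definition homogenised :: "rat poly \<Rightarrow> rat poly poly \<Rightarrow> rat poly poly \<Rightarrow> rat poly poly" where
  "homogenised m G D = (\<Sum>i\<le>degree m. [:[:coeff m i:]:] * G ^ i * D ^ (degree m - i))"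

lemma bpoly_homogenised:
  "bpoly (homogenised m G D) t r =
     (\<Sum>i\<le>degree m. of_rat (coeff m i) * bpoly G t r ^ i * bpoly D t r ^ (degree m - i))"
  by (simp add: homogenised_def bpoly_sum mult.assoc)

lemma bpoly_homogenised_zero:
  assumes "bpoly D t r \<noteq> 0" "rpoly m (bpoly G t r / bpoly D t r) = 0"
  shows "bpoly (homogenised m G D) t r = 0"
proof -
  define g d where "g = bpoly G t r" and "d = bpoly D t r"
  have "bpoly (homogenised m G D) t r = (\<Sum>i\<le>degree m. d ^ degree m * (of_rat (coeff m i) * (g / d) ^ i))"
    unfolding bpoly_homogenised g_def[symmetric] d_def[symmetric]
  proof (intro sum.cong refl)
    fix i assume "i \<in> {..degree m}"
    then have "d ^ degree m = d ^ i * d ^ (degree m - i)" by (simp flip: power_add)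
    then show "of_rat (coeff m i) * g ^ i * d ^ (degree m - i) = d ^ degree m * (of_rat (coeff m i) * (g / d) ^ i)"
      using assms(1) by (simp add: d_def power_divide)
  qed
  also have "\<dots> = d ^ degree m * rpoly m (g / d)"
    by (simp add: rpoly_def poly_altdef coeff_map_poly sum_distrib_left)
  finally show ?thesis using assms(2) by (simp add: g_def d_def)
qed

text \<open>Where the denominator of j vanishes and its numerator does not, only the leading term of
  \<open>m\<close> remains: j has a pole there.\<close>

lemma bpoly_homogenised_at_cusp:
  assumes "bpoly D t r = 0" "m \<noteq> 0" "bpoly G t r \<noteq> 0"
  shows "bpoly (homogenised m G D) t r \<noteq> 0"
proof -
  have "bpoly (homogenised m G D) t r = (\<Sum>i\<in>{degree m}. of_rat (coeff m i) * bpoly G t r ^ i)"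
    unfolding bpoly_homogenised assms(1)
    by (rule sum.mono_neutral_cong_right) auto
  then show ?thesis using assms by simp
qed

section \<open>Membership of j-invariants in the number field, and the case of order at least
  4\<close>

definition j_invariants :: "nat \<Rightarrow> nat \<Rightarrow> complex set" where
  "j_invariants N p = {j::complex. algebraic j \<and>
           (\<exists>F E P. number_field F \<and> \<not> p dvd degree_over_rat F \<and>
                    elliptic_curve_over F E \<and> j_invariant E = j \<and>
                    P \<in> carrier (point_group F E) \<and>
                    has_order (point_group F E) P N)}"

lemma mem_j_invariants:
  assumes "number_field F" "\<not> p dvd degree_over_rat F" "elliptic_curve_over F E"
    "P \<in> rational_points F E" "has_order (point_group F E) P N" "j_invariant E \<in> F"
  shows "j_invariant E \<in> j_invariants N p"
  using assms algebraic_if_in_number_field[OF assms(1,6)]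
  unfolding j_invariants_def by (auto simp: point_group_def)

lemma number_field_power:
  assumes "subfield F complex_ring" "x \<in> F"
  shows "x ^ n \<in> F"
  by (induction n) (simp_all add: subfield_complex_ringD[OF assms(1)] assms(2))

lemma number_field_divide:
  assumes "subfield F complex_ring" "x \<in> F" "y \<in> F" "y \<noteq> 0"
  shows "x / y \<in> F"
  using subfield_complex_ringD(3)[OF assms(1,2), of "inverse y"]
    CR.subfield_m_inv(1)[OF assms(1), of y] assms(3,4)
  by (simp add: complex_ring_inv divide_inverse)

lemma number_field_numeral:
  assumes "subfield F complex_ring"
  shows "numeral n \<in> F"
proof -
  have "of_nat k \<in> F" for k
    by (induction k) (use subfield_complex_ringD[OF assms] CR.zero_closed subringE(2)[OF subfieldE(1)[OF assms]] in auto)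
  from this[of "numeral n"] show ?thesis by simp
qed

lemma j_invariant_in_number_field:
  assumes F: "subfield F complex_ring" and E: "elliptic_curve_over F E"
  shows "j_invariant E \<in> F"
proof -
  note D = subfield_complex_ringD[OF F]
  have minus: "x - y \<in> F" if "x \<in> F" "y \<in> F" for x y
    using D(2)[OF that(1) D(4)[OF that(2)]] by simp
  note closure = D minus number_field_power[OF F] number_field_numeral[OF F]
  have "wa1 E \<in> F" "wa2 E \<in> F" "wa3 E \<in> F" "wa4 E \<in> F" "wa6 E \<in> F"
    using E by (cases E; simp add: elliptic_curve_over_def)+
  note closure = closure this
  have b: "wb2 E \<in> F" "wb4 E \<in> F" "wb6 E \<in> F" "wb8 E \<in> F"
    unfolding wb2_def wb4_def wb6_def wb8_def by (intro closure)+
  have "wc4 E \<in> F" unfolding wc4_def by (intro closure b)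
  moreover have "discriminant E \<in> F" unfolding discriminant_def by (intro closure b)
  ultimately show ?thesis
    unfolding j_invariant_def using E
    by (intro number_field_divide[OF F] closure) (simp_all add: elliptic_curve_over_def)
qed

text \<open>If the set were finite, each member would supply one polynomial condition to avoid. The
  curve found by avoiding them all has its j-invariant in the set, contradicting its own
  condition.\<close>

lemma infinite_j_invariants_large:
  assumes "prime p"
  shows "infinite (j_invariants (K + 4) p)"
proof
  assume fin: "finite (j_invariants (K + 4) p)"
  define T R :: "rat poly poly" where "T = [:[:0, 1:]:]" and "R = [:0, 1:]"
  define A where "A = 1 + 2 * T + R * T ^ (K + 1)"
  have T: "bpoly T t r = t" and R: "bpoly R t r = r" for t r :: "'a::field_char_0"
    by (simp_all add: T_def R_def)
  have A: "bpoly A t r = 1 + 2 * t + r * t ^ (K + 1)" for t r :: "'a::field_char_0"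
    by (simp add: A_def T R)
  define D where "D = family_disc A T"
  define G where "G = family_c4 A T ^ 3"
  obtain m where m: "\<And>j. j \<in> j_invariants (K + 4) p \<Longrightarrow> m j \<noteq> 0 \<and> rpoly (m j) j = 0"
  proof -
    have "\<forall>j\<in>j_invariants (K + 4) p. \<exists>q. q \<noteq> 0 \<and> rpoly q j = 0"
      unfolding j_invariants_def using algebraic_imp_rpoly_root by blast
    then show ?thesis using that by (metis bchoice)
  qed
  \<comment> \<open>In turn: a3 and a2 must not vanish, the curve must be nonsingular, the order
    must not be smaller, and j must be new.\<close>
  define \<H> where "\<H> = {T, 1 - T, D} \<union> slope_num A T ` {..<K} \<union> (\<lambda>j. homogenised (m j) G D) ` j_invariants (K + 4) p"
  obtain e \<kappa> where \<kappa>: "\<kappa> \<noteq> 0"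
    "\<And>r. ((\<lambda>t. slope_num (1 + 2 * t + r * t ^ (K + 1)) t K / t ^ e) \<longlongrightarrow> \<kappa> * (1 + r)) (at (0::real))"
    using slope_num_asymp_last[of K] by blast
  then have "((\<lambda>t. bpoly (slope_num A T K) t r / t ^ e) \<longlongrightarrow> \<kappa> * (1 + r)) (at 0)" for r :: real
    by (simp add: bpoly_slope_num A T)
  then obtain H where H: "slope_num A T K = T ^ e * H" "\<And>r :: real. bpoly H 0 r = \<kappa> * (1 + r)"
    using limit_factor_out_t[of "slope_num A T K" e "\<lambda>r. \<kappa> * (1 + r)" 0] \<kappa>(1) unfolding T_def by auto
  obtain \<pi> where \<pi>: "prime_elem \<pi>" "degree \<pi> > 0" "\<pi> dvd H" "poly (fibre0 \<pi>) (-1) = 0"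
    "poly (pderiv (fibre0 \<pi>)) (-1) \<noteq> 0"
    using component_through_cusp[OF H(2) \<kappa>(1)] by blast
  have fib: "fibre0 \<pi> \<noteq> 0" using \<pi>(5) by auto
  have at_cusp: "bpoly A 0 (- 1 :: rat) = 1" "bpoly D 0 (- 1 :: rat) = 0" "bpoly G 0 (- 1 :: rat) = 1"
    by (simp_all add: D_def G_def bpoly_family_disc bpoly_family_c4 A T family_disc_def family_c4_def)
  have "\<not> \<pi> dvd B" if "B \<in> \<H>" for B
  proof -
    consider "B = T" | "B = 1 - T" | "B = D" | i where "i < K" "B = slope_num A T i"
      | j where "j \<in> j_invariants (K + 4) p" "B = homogenised (m j) G D"
      using \<open>B \<in> \<H>\<close> unfolding \<H>_def by blast
    then show ?thesis
    proof cases
      case 1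
      then show ?thesis using not_dvd_t[OF \<pi>(1) fib] by (simp add: T_def)
    next
      case 2
      then show ?thesis
        by (intro not_dvd_if_nonzero_at_cusp[OF \<pi>(4)]) (simp add: poly_fibre0 T)
    next
      case 3
      \<comment> \<open>The order of the discriminant along t = 0 is K + 4, namely 3 from the
        explicit factor and K + 1 from \<open>d\<close>. The cofactor \<open>W\<close> has the value
        1 at the cusp.\<close>
      define d where "d = R * T ^ (K + 1)"
      define V where "V = - (1 - T) * (2 * (1 + 8 * T) * (2 * (1 + 2 * T) + d) + d * (2 * (1 + 2 * T) + d) ^ 2)
        + 3 * (1 + 2 * T) ^ 2 + 3 * (1 + 2 * T) * d + d ^ 2 + 36 * T * (1 - T)"
      define W where "W = R * V"
      have "D = T ^ 3 * d * V"
        unfolding D_def A_def V_def d_def by (rule family_disc_nodal)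
      also have "\<dots> = T ^ (K + 4) * W"
        by (simp add: d_def W_def power_add eval_nat_numeral mult_ac)
      finally have "D = T ^ (K + 4) * W" .
      moreover have "poly (fibre0 W) (-1) \<noteq> 0"
        by (simp add: poly_fibre0 W_def V_def d_def T R)
      ultimately show ?thesis
        unfolding 3 T_def by (rule not_dvd_by_order[OF \<pi>(1) fib \<pi>(4)])
    next
      case 4
      obtain e \<kappa> where \<kappa>: "\<kappa> \<noteq> 0"
        "\<And>r. ((\<lambda>t. slope_num (1 + 2 * t + r * t ^ (K + 1)) t i / t ^ e) \<longlongrightarrow> \<kappa>) (at (0::real))"
        using slope_num_asymp[OF 4(1)] by blast
      then have "((\<lambda>t. bpoly B t r / t ^ e) \<longlongrightarrow> \<kappa>) (at 0)" for r :: real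
        by (simp add: 4(2) bpoly_slope_num A T)
      then obtain B' where B': "B = T ^ e * B'" "\<And>r :: real. bpoly B' 0 r = \<kappa>"
        using limit_factor_out_t[of B e "\<lambda>r. \<kappa>" 0] \<kappa>(1) unfolding T_def by auto
      have "of_rat (poly (fibre0 B') (-1)) = \<kappa>"
        using B'(2)[of "-1"] rpoly_of_rat[of "fibre0 B'" "-1", where 'a = real] by (simp add: bpoly_at_0)
      then have "poly (fibre0 B') (-1) \<noteq> 0" using \<kappa>(1) by auto
      with B'(1) show ?thesis
        unfolding T_def by (rule not_dvd_by_order[OF \<pi>(1) fib \<pi>(4)])
    next
      case 5
      then show ?thesis
        using bpoly_homogenised_at_cusp[OF at_cusp(2), of "m j" G] m at_cusp(3)
        by (intro not_dvd_if_nonzero_at_cusp[OF \<pi>(4)]) (simp add: poly_fibre0)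
    qed
  qed
  moreover have "finite \<H>" using fin by (simp add: \<H>_def)
  ultimately obtain g z r where g: "irreducible g" "\<not> p dvd degree g" "rpoly g z = 0" "z \<noteq> 0"
    and r: "r \<in> adjoin z" "bpoly \<pi> z r = 0" "\<And>H. H \<in> \<H> \<Longrightarrow> bpoly H z r \<noteq> 0"
    using generic_point_of_degree_prime_to[OF \<pi>(1,2,4,5) assms, of \<H>] by metis
  define c where "c = 1 + 2 * z + r * z ^ (K + 1)"
  define E where "E = family_curve c z"
  note F = subfield_adjoin[OF g(1,3)]
  have z1: "1 - z \<noteq> 0" using r(3)[of "1 - T"] by (simp add: \<H>_def T)
  have disc: "discriminant E \<noteq> 0"
    using r(3)[of D] by (simp add: \<H>_def E_def discriminant_family D_def bpoly_family_disc A T c_def)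
  have num: "\<forall>i<K. slope_num c z i \<noteq> 0"
  proof (intro allI impI)
    fix i assume "i < K"
    then have "bpoly (slope_num A T i) z r \<noteq> 0" by (intro r(3)) (simp add: \<H>_def)
    then show "slope_num c z i \<noteq> 0" by (simp add: bpoly_slope_num A T c_def)
  qed
  have "bpoly H z r = 0" using \<pi>(3) r(2) by (auto elim!: dvdE)
  then have num_K: "slope_num c z K = 0"
    using H(1) by (metis A T bpoly_mult bpoly_slope_num c_def mult_zero_right)
  have slope: "slope c (z * (1 - z)) z i = 0 \<longleftrightarrow> slope_num c z i = 0" if "i \<le> K" for i
  proof -
    obtain x x' l l' where eq: "cleared c z i = (x, x', l, l')" by (metis prod_cases4)
    then show ?thesis
      using cleared_multiple[OF g(4) z1 _ eq] num that by (simp add: slope_num_def)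
  qed
  have "has_order (point_group (adjoin z) E) (Affine 0 0) (K + 4)"
    unfolding E_def family_curve_def
    by (rule has_order_origin) (use g(4) z1 slope num num_K in auto)
  moreover have "c \<in> adjoin z" "z \<in> adjoin z" "z * (1 - z) \<in> adjoin z" "0 \<in> adjoin z"
  proof -
    note Fc = subfield_complex_ringD[OF F] number_field_power[OF F] number_field_numeral[OF F]
    show z: "z \<in> adjoin z" by (rule adjoin_generator)
    show "0 \<in> adjoin z" using adjoinI[of 0 z] by simp
    show "c \<in> adjoin z" unfolding c_def by (intro Fc z r)
    have "z * (1 + - z) \<in> adjoin z" by (intro Fc z)
    then show "z * (1 - z) \<in> adjoin z" by simp
  qed
  then have "elliptic_curve_over (adjoin z) E" "Affine 0 0 \<in> rational_points (adjoin z) E"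
    using disc by (simp_all add: elliptic_curve_over_def E_def family_curve_def rational_points_def)
  ultimately have j: "j_invariant E \<in> j_invariants (K + 4) p"
    using number_field_adjoin[OF g(1,3)] g(2) j_invariant_in_number_field[OF F]
    by (intro mem_j_invariants) auto
  have "j_invariant E = bpoly G z r / bpoly D z r"
    by (simp add: j_invariant_def G_def D_def bpoly_family_disc bpoly_family_c4 A T E_def
        discriminant_family wc4_family c_def)
  then have "bpoly (homogenised (m (j_invariant E)) G D) z r = 0"
    using m[OF j] r(3)[of D] by (intro bpoly_homogenised_zero) (auto simp: \<H>_def)
  then show False using r(3) j by (auto simp: \<H>_def)
qed


subsection \<open>Small orders\<close>

text \<open>The ratio has a pole at 0, so P - j Q is a nonzero polynomial for every j, and each
  value is taken only finitely often.\<close>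

lemma infinite_ratio_values:
  fixes P Q :: "rat poly"
  assumes "poly P 0 \<noteq> 0" "poly Q 0 = 0" "Q \<noteq> 0"
  shows "infinite ((\<lambda>t. of_rat (poly P t / poly Q t) :: complex) ` {t. poly Q t \<noteq> 0})"
proof
  assume fin: "finite ((\<lambda>t. of_rat (poly P t / poly Q t) :: complex) ` {t. poly Q t \<noteq> 0})"
  have "finite {t. poly Q t = 0}" using assms(3) by (rule poly_roots_finite)
  moreover have "{t. poly Q t \<noteq> 0} = UNIV - {t. poly Q t = 0}" by auto
  ultimately have "infinite {t. poly Q t \<noteq> 0}" by (simp add: infinite_UNIV_char_0)
  then obtain s where s: "poly Q s \<noteq> 0"
    "infinite {t \<in> {t. poly Q t \<noteq> 0}. of_rat (poly P t / poly Q t) = (of_rat (poly P s / poly Q s) :: complex)}"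
    using pigeonhole_infinite[OF _ fin] by blast
  define j where "j = poly P s / poly Q s"
  have "poly (P - smult j Q) 0 \<noteq> 0" using assms(1,2) by simp
  then have "P - smult j Q \<noteq> 0" by (metis poly_0)
  then have "finite {t. poly (P - smult j Q) t = 0}" by (rule poly_roots_finite)
  moreover have "{t \<in> {t. poly Q t \<noteq> 0}. of_rat (poly P t / poly Q t) = (of_rat (poly P s / poly Q s) :: complex)}
      \<subseteq> {t. poly (P - smult j Q) t = 0}"
    by (auto simp: j_def[symmetric] field_simps)
  ultimately show False using s(2) finite_subset by blast
qed

lemma infinite_j_invariants_rational_family:
  fixes E :: "rat \<Rightarrow> complex weierstrass" and P Q :: "rat poly"
  assumes "prime p" and PQ: "poly P 0 \<noteq> 0" "poly Q 0 = 0" "Q \<noteq> 0"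
    and E: "\<And>t. set_weierstrass (E t) \<subseteq> \<rat>" "\<And>t. wc4 (E t) ^ 3 = of_rat (poly P t)"
      "\<And>t. discriminant (E t) = of_rat (poly Q t)"
    and B: "\<And>t F. poly Q t \<noteq> 0 \<Longrightarrow> 0 \<in> F \<Longrightarrow> B \<in> rational_points F (E t)"
      "\<And>t F. poly Q t \<noteq> 0 \<Longrightarrow> has_order (point_group F (E t)) B N"
  shows "infinite (j_invariants N p)"
proof -
  \<comment> \<open>\<open>adjoin 0\<close> is Q itself, with minimal polynomial X of degree
    1.\<close>
  have X: "irreducible [:0, 1 :: rat:]" "rpoly [:0, 1:] (0 :: complex) = 0"
    by (simp_all add: irreducible_linear_field_poly)
  note F = subfield_adjoin[OF X] and nf = number_field_adjoin[OF X]
  have rat: "of_rat q \<in> adjoin 0" for q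
    using adjoinI[of "[:q:]" 0] by simp
  have "\<not> p dvd degree_over_rat (adjoin 0)"
    using assms(1) nf(2) by auto
  moreover have "elliptic_curve_over (adjoin 0) (E t)" if "poly Q t \<noteq> 0" for t
    using E(1)[of t] E(3)[of t] that rat by (auto simp: elliptic_curve_over_def Rats_def)
  moreover have "0 \<in> adjoin 0" using rat[of 0] by simp
  ultimately have "j_invariant (E t) \<in> j_invariants N p" if "poly Q t \<noteq> 0" for t
    using that nf(1) B j_invariant_in_number_field[OF F] by (intro mem_j_invariants) auto
  moreover have "j_invariant (E t) = of_rat (poly P t / poly Q t)" for t
    by (simp add: j_invariant_def E of_rat_divide)
  ultimately have "(\<lambda>t. of_rat (poly P t / poly Q t)) ` {t. poly Q t \<noteq> 0} \<subseteq> j_invariants N p"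
    by auto
  then show ?thesis using infinite_ratio_values[OF PQ] finite_subset by blast
qed

text \<open>On y^2 + x y = x^3 + t x the tangent at the origin is vertical, which gives order 2. On
  y^2 + x y + t y = x^3 the origin is a flex with tangent y = 0, which gives order 3; the same
  family with the point at infinity covers N = 1.\<close>

lemma infinite_j_invariants_small:
  assumes "prime p" "N \<in> {1, 2, 3}"
  shows "infinite (j_invariants N p)"
proof -
  consider "N = 2" | "N = 1 \<or> N = 3" using assms(2) by auto
  then show ?thesis
  proof cases
    case 1
    show ?thesis
    proof (rule infinite_j_invariants_rational_family[OF assms(1)])
      fix t :: rat
      let ?E = "Weierstrass 1 0 0 (of_rat t) 0 :: complex weierstrass"
      show "set_weierstrass ?E \<subseteq> \<rat>" by auto
      show "wc4 ?E ^ 3 = of_rat (poly ([:1, -48:] ^ 3) t)"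
        by (simp add: wc4_def wb2_def wb4_def of_rat_power of_rat_diff of_rat_mult mult.commute)
      show "discriminant ?E = of_rat (poly ([:0, 0, 1:] * [:1, -64:]) t)"
        by (simp add: discriminant_def wb2_def wb4_def wb6_def wb8_def of_rat_power of_rat_diff
            of_rat_mult algebra_simps eval_nat_numeral)
      fix F :: "complex set"
      show "0 \<in> F \<Longrightarrow> Affine 0 0 \<in> rational_points F ?E"
        by (simp add: rational_points_def)
      show "has_order (point_group F ?E) (Affine 0 0) N"
        using 1 by (auto simp: has_order_def point_group_def numeral_2_eq_2 less_Suc_eq)
    qed simp_all
  next
    case 2
    show ?thesis
    proof (rule infinite_j_invariants_rational_family[OF assms(1)])
      fix t :: rat
      let ?E = "Weierstrass 1 0 (of_rat t) 0 0 :: complex weierstrass"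
      let ?B = "if N = 1 then Infinity else Affine 0 0 :: complex point"
      show "set_weierstrass ?E \<subseteq> \<rat>" by auto
      show "wc4 ?E ^ 3 = of_rat (poly ([:1, -24:] ^ 3) t)"
        by (simp add: wc4_def wb2_def wb4_def of_rat_power of_rat_diff of_rat_mult mult.commute)
      show "discriminant ?E = of_rat (poly ([:0, 0, 0, 1:] * [:1, -27:]) t)"
        by (simp add: discriminant_def wb2_def wb4_def wb6_def wb8_def of_rat_power of_rat_diff
            of_rat_mult algebra_simps eval_nat_numeral)
      fix F :: "complex set"
      show "0 \<in> F \<Longrightarrow> ?B \<in> rational_points F ?E"
        by (simp add: rational_points_def)
      assume "poly ([:0, 0, 0, 1:] * [:1, -27:]) t \<noteq> 0"
      then have "t \<noteq> 0" by auto
      then show "has_order (point_group F ?E) ?B N"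
        using 2 by (auto simp: has_order_def point_group_def numeral_3_eq_3 less_Suc_eq Let_def)
    qed simp_all
  qed
qed

theorem theorem7p1:
  fixes N p :: nat
  assumes "N > 0" and "prime p"
  shows "infinite {j::complex. algebraic j \<and>
           (\<exists>F E P. number_field F \<and> \<not> p dvd degree_over_rat F \<and>
                    elliptic_curve_over F E \<and> j_invariant E = j \<and>
                    P \<in> carrier (point_group F E) \<and>
                    has_order (point_group F E) P N)}"
proof -
  have "N \<in> {1, 2, 3} \<or> N = (N - 4) + 4" using assms(1) by auto
  then have "infinite (j_invariants N p)"
    using infinite_j_invariants_small[OF assms(2)] infinite_j_invariants_large[OF assms(2)] by metis
  then show ?thesis unfolding j_invariants_def .
qed

end
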